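(* Let $\mathbf{P}=(P,\preceq_+,\preceq_-)$ be a double poset. Then $\mathcal{C}(P_+)-\mathcal{C}(P_-)$ is a lattice polytope with respect to $\mathbb{Z}^P$, and for every integer $n\ge1$ \[\big|(n-1)(\mathcal{C}(P_+)-\mathcal{C}(P_-))\cap\mathbb{Z}^P\big|=\sum_{P=P_1\uplus P_2}\Omega^\circ_{(P_1,\preceq_+)}(n-1)\cdot\Omega_{(P_2,\preceq_-)}(n),\] and \[\mathrm{nvol}(\mathcal{C}(P_+)-\mathcal{C}(P_-))=\sum_{P=P_1\uplus P_2}\binom{|P|}{|P_1|}e(P_1,\preceq_+)\cdot e(P_2,\preceq_-),\] where the sums range over ordered partitions of $P$ into two (possibly empty) disjoint subsets.
   Context: A double poset is a finite set $P$ with two partial orders $\preceq_+,\preceq_-$; $P_\sigma=(P,\preceq_\sigma)$. For a poset $Q$, $\mathcal{C}(Q)=\{g:Q\to\mathbb{R}_{\ge0}:\sum_{a\in C}g(a)\le1\text{ for all chains }C\}$. For $P_1\subseteq P$, $(P_1,\preceq_\sigma)$ is the induced subposet. $\Omega_Q(n)$ is the number of order-preserving maps $Q\to[n]$ ($a\preceq b\Rightarrow f(a)\le f(b)$), $\Omega^\circ_Q(n)$ the number of strictly order-preserving maps $Q\to[n]$ ($a\prec b\Rightarrow f(a)<f(b)$), $e(Q)$ the number of linear extensions (all equal to $1$ for the empty poset). $\mathrm{nvol}$ is the normalized volume with respect to $\mathbb{Z}^P$, i.e. $|P|!$ times Euclidean volume. *)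

theory Defs
  imports "HOL-Analysis.Analysis" "HOL-Library.Function_Algebras"
begin

text \<open>
  The vector space \<open>\<real>\<^sup>P\<close> of a finite (possibly empty) set \<open>P :: 'a set\<close> is represented
  by the functions \<open>'a \<Rightarrow> real\<close> that vanish outside \<open>P\<close>. The pointwise real vector space
  structure on functions makes the library's \<^const>\<open>hull\<close> and \<^const>\<open>convex\<close> applicable.
\<close>

instantiation "fun" :: (type, real_vector) real_vector
begin

definition "scaleR c f = (\<lambda>x. c *\<^sub>R f x)"

instance
  by standard (auto simp: scaleR_fun_def fun_eq_iff scaleR_add_right scaleR_add_left)

end

definition double_poset :: "'a set \<Rightarrow> 'a rel \<Rightarrow> 'a rel \<Rightarrow> bool" where
  "double_poset P rp rm \<longleftrightarrow> finite P \<and> partial_order_on P rp \<and> partial_order_on P rm"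

definition chain_polytope :: "'a set \<Rightarrow> 'a rel \<Rightarrow> ('a \<Rightarrow> real) set" where
  "chain_polytope P r =
     {g. (\<forall>a\<in>P. 0 \<le> g a) \<and> (\<forall>a. a \<notin> P \<longrightarrow> g a = 0) \<and>
         (\<forall>C\<subseteq>P. C \<in> Chains r \<longrightarrow> (\<Sum>a\<in>C. g a) \<le> 1)}"

definition minkowski_diff :: "'v::ab_group_add set \<Rightarrow> 'v set \<Rightarrow> 'v set" where
  "minkowski_diff A B = {x - y | x y. x \<in> A \<and> y \<in> B}"

definition int_lattice :: "'a set \<Rightarrow> ('a \<Rightarrow> real) set" where
  "int_lattice P = {g. (\<forall>a\<in>P. g a \<in> \<int>) \<and> (\<forall>a. a \<notin> P \<longrightarrow> g a = 0)}"

definition lattice_polytope :: "'a set \<Rightarrow> ('a \<Rightarrow> real) set \<Rightarrow> bool" where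
  "lattice_polytope P S \<longleftrightarrow> (\<exists>V. finite V \<and> V \<subseteq> int_lattice P \<and> S = convex hull V)"

text \<open>
  Points of the product measure space on \<open>P\<close> are \<^const>\<open>undefined\<close> outside \<open>P\<close> rather than zero,
  hence the restriction before measuring.
\<close>

definition nvol :: "'a set \<Rightarrow> ('a \<Rightarrow> real) set \<Rightarrow> real" where
  "nvol P S = fact (card P) * measure (Pi\<^sub>M P (\<lambda>_. lborel)) ((\<lambda>g. restrict g P) ` S)"

definition order_poly :: "'a set \<Rightarrow> 'a rel \<Rightarrow> nat \<Rightarrow> nat" where
  "order_poly Q r n = card {f \<in> Q \<rightarrow>\<^sub>E {1..n}. \<forall>a\<in>Q. \<forall>b\<in>Q. (a, b) \<in> r \<longrightarrow> f a \<le> f b}"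

definition strict_order_poly :: "'a set \<Rightarrow> 'a rel \<Rightarrow> nat \<Rightarrow> nat" where
  "strict_order_poly Q r n =
     card {f \<in> Q \<rightarrow>\<^sub>E {1..n}. \<forall>a\<in>Q. \<forall>b\<in>Q. (a, b) \<in> r \<and> a \<noteq> b \<longrightarrow> f a < f b}"

definition num_lin_ext :: "'a set \<Rightarrow> 'a rel \<Rightarrow> nat" where
  "num_lin_ext Q r = card {l. linear_order_on Q l \<and> r \<subseteq> l}"

definition ordered_bipartitions :: "'a set \<Rightarrow> ('a set \<times> 'a set) set" where
  "ordered_bipartitions P = {(P1, P2). P1 \<union> P2 = P \<and> P1 \<inter> P2 = {}}"

end

theory Submission
  imports Defs "HOL-Real_Asymp.Real_Asymp"
begin

text \<open>
  Chain polytopes are closed under decreasing coordinates towards zero, so a point lies in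
  \<open>m (\<C>(P\<^sub>+) - \<C>(P\<^sub>-))\<close> iff its positive and negative parts have chain sums at most \<open>m\<close> with respect to
  \<open>\<preceq>\<^sub>+\<close> and \<open>\<preceq>\<^sub>-\<close>. Splitting the lattice points by sign, Stanley's transfer map
  \<open>f \<mapsto> (\<lambda>a. f a - max {f b | b. b < a})\<close> matches order-preserving maps with weights of bounded chain
  sums, and strictly order-preserving maps with the positive ones among these weights.
  For the volume, subdivide space into cubes of side \<open>1/k\<close>: the cubes inside the polytope and those
  meeting it are again counted by order polynomials, which grow like \<open>e(Q) k\<^bsup>|Q|\<^esup> / |Q|!\<close> because
  almost all maps into \<open>{1..k}\<close> are injective.
\<close>

section \<open>Chains and the transfer map\<close>

text \<open>Zero coordinates decide the shape of the lattice point formula: splitting by sign is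
  unambiguous only if zero belongs to one side. It is put with the negative part, so the weights
  bounded by \<open>rp\<close> are at least 1 and those bounded by \<open>rm\<close> at least 0.
  With chain sums at most \<open>n - 1\<close>, the former correspond to strict maps into
  \<open>{1..n - 1}\<close>, the latter to weak maps into \<open>{0..n - 1}\<close>, which has
  \<open>n\<close> values. The volume comes from a squeeze, without an Ehrhart polynomial. The inner
  cubes are counted by strict times strict maps into \<open>k\<close> values, the outer ones by weak
  times weak maps into \<open>k + 1\<close> values. Both sums have the same leading coefficient, a
  sum of e(P1) e(P2) / (|P1|! |P2|!), and multiplying by |P|! produces the binomials. That the
  vertices are integral is a separate matter: a chain polytope is the hull of the indicators of its
  antichains, and a difference of hulls is the hull of the pairwise differences.\<close>

definition chain_bounded :: "'a set \<Rightarrow> 'a rel \<Rightarrow> 'b::{comm_monoid_add,ord} \<Rightarrow> ('a \<Rightarrow> 'b) \<Rightarrow> bool" where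
  "chain_bounded Q r m g \<longleftrightarrow> (\<forall>C\<subseteq>Q. C \<in> Chains r \<longrightarrow> sum g C \<le> m)"

lemma chain_boundedD: "chain_bounded Q r m g \<Longrightarrow> C \<subseteq> Q \<Longrightarrow> C \<in> Chains r \<Longrightarrow> sum g C \<le> m"
  by (auto simp: chain_bounded_def)

lemma partial_order_onD:
  assumes "partial_order_on Q r"
  shows "r \<subseteq> Q \<times> Q" "\<And>a. a \<in> Q \<Longrightarrow> (a, a) \<in> r" "trans r" "antisym r"
  using assms by (auto simp: partial_order_on_def preorder_on_def refl_on_def)

lemma chain_bounded_singletonD:
  assumes "partial_order_on Q r" "chain_bounded Q r m g" "a \<in> Q"
  shows "g a \<le> m"
proof -
  have "{a} \<in> Chains r" using partial_order_onD(2)[OF assms(1,3)] by (simp add: Chains_def)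
  then show ?thesis using chain_boundedD[OF assms(2), of "{a}"] assms(3) by simp
qed

lemma Chains_subset: "C \<in> Chains r \<Longrightarrow> B \<subseteq> C \<Longrightarrow> B \<in> Chains r"
  by (auto simp: Chains_def)

lemma finite_chain_has_top:
  assumes "trans r" "finite C" "C \<noteq> {}" "C \<in> Chains r"
  shows "\<exists>c\<in>C. \<forall>b\<in>C. (b, c) \<in> r"
  using assms(2-4)
proof (induction C rule: finite_ne_induct)
  case (singleton x)
  then show ?case by (simp add: Chains_def)
next
  case (insert x F)
  then obtain c where c: "c \<in> F" "\<forall>b\<in>F. (b, c) \<in> r"
    using Chains_subset[of "insert x F" r F] by blast
  have "(x, c) \<in> r \<or> (c, x) \<in> r" "(x, x) \<in> r" using insert.prems c(1) by (auto simp: Chains_def)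
  then show ?case
  proof (elim disjE)
    assume "(c, x) \<in> r"
    then have "\<forall>b\<in>F. (b, x) \<in> r" using c(2) transD[OF assms(1), of _ c x] by simp
    then show ?thesis using \<open>(x, x) \<in> r\<close> by simp
  qed (use c in auto)
qed

lemma finite_chain_has_bottom:
  assumes "trans r" "finite C" "C \<noteq> {}" "C \<in> Chains r"
  shows "\<exists>c\<in>C. \<forall>b\<in>C. (c, b) \<in> r"
  using finite_chain_has_top[of "r\<inverse>" C] assms by (auto simp: Chains_def)

lemma Chains_insert_below:
  assumes "C \<in> Chains r" "(a, a) \<in> r" "\<And>b. b \<in> C \<Longrightarrow> (a, b) \<in> r"
  shows "insert a C \<in> Chains r"
  using assms by (auto simp: Chains_def)

lemma Chains_insert_above:
  assumes "C \<in> Chains r" "(a, a) \<in> r" "\<And>b. b \<in> C \<Longrightarrow> (b, a) \<in> r"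
  shows "insert a C \<in> Chains r"
  using assms by (auto simp: Chains_def)

lemma partial_order_on_Restr:
  assumes "partial_order_on P r" "Q \<subseteq> P"
  shows "partial_order_on Q (Restr r Q)"
  using assms trans_Restr[of r Q] unfolding partial_order_on_def preorder_on_def refl_on_def
  by (auto intro: antisym_subset)

text \<open>Only chains inside \<open>Q\<close> are tested, and there \<open>r\<close> and its
  restriction agree. Bounds on \<open>P\<close> can thus be passed to the counting lemmas, which
  need a partial order on the subset itself.\<close>

lemma chain_bounded_Restr: "chain_bounded Q (Restr r Q) m g \<longleftrightarrow> chain_bounded Q r m g"
  unfolding chain_bounded_def Chains_def by blast

text \<open>The inserted 0 serves the minimal elements. For monotone \<open>f\<close>, ranging over
  all strictly smaller elements gives the same maximum as ranging over the covered ones, so no cover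
  relation is needed.\<close>

definition under_max :: "'a rel \<Rightarrow> ('a \<Rightarrow> nat) \<Rightarrow> 'a \<Rightarrow> nat" where
  "under_max r f a = Max (insert 0 (f ` underS r a))"

definition transfer :: "'a set \<Rightarrow> 'a rel \<Rightarrow> ('a \<Rightarrow> nat) \<Rightarrow> 'a \<Rightarrow> nat" where
  "transfer Q r f = (\<lambda>a\<in>Q. f a - under_max r f a)"

definition monotone_maps :: "'a set \<Rightarrow> 'a rel \<Rightarrow> nat set \<Rightarrow> ('a \<Rightarrow> nat) set" where
  "monotone_maps Q r N = {f \<in> Q \<rightarrow>\<^sub>E N. \<forall>a\<in>Q. \<forall>b\<in>Q. (a, b) \<in> r \<longrightarrow> f a \<le> f b}"

definition strict_monotone_maps :: "'a set \<Rightarrow> 'a rel \<Rightarrow> nat set \<Rightarrow> ('a \<Rightarrow> nat) set" where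
  "strict_monotone_maps Q r N =
     {f \<in> Q \<rightarrow>\<^sub>E N. \<forall>a\<in>Q. \<forall>b\<in>Q. (a, b) \<in> r \<and> a \<noteq> b \<longrightarrow> f a < f b}"

text \<open>The lower bound \<open>s\<close> is 0 or 1: weights from 0 correspond to weakly, weights
  from 1 to strictly order-preserving maps.\<close>

definition chain_bounded_maps :: "'a set \<Rightarrow> 'a rel \<Rightarrow> nat \<Rightarrow> nat \<Rightarrow> ('a \<Rightarrow> nat) set" where
  "chain_bounded_maps Q r s k = {g \<in> Q \<rightarrow>\<^sub>E {s..}. chain_bounded Q r k g}"

context
  fixes Q :: "'a set" and r :: "'a rel"
  assumes finite_Q: "finite Q" and po: "partial_order_on Q r"
begin

lemma underS_subset: "underS r a \<subseteq> Q"
  using partial_order_onD(1)[OF po] by (auto simp: underS_def)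

lemma finite_underS: "finite (underS r a)"
  using finite_subset[OF underS_subset finite_Q] .

lemma underS_mono: "b \<in> underS r a \<Longrightarrow> underS r b \<subseteq> underS r a"
  using partial_order_onD(3,4)[OF po] unfolding underS_def trans_def antisym_def by blast

text \<open>Makes the number of strictly smaller elements a measure for induction along the order,
  and a rank function when the order is linear.\<close>

lemma card_underS_less: "b \<in> underS r a \<Longrightarrow> card (underS r b) < card (underS r a)"
proof (rule psubset_card_mono[OF finite_underS], rule psubsetI)
  assume "b \<in> underS r a"
  moreover have "b \<notin> underS r b" by (simp add: underS_def)
  ultimately show "underS r b \<noteq> underS r a" by blast
qed (rule underS_mono)

lemma under_max_ge: "b \<in> underS r a \<Longrightarrow> f b \<le> under_max r f a"
  unfolding under_max_def by (rule Max_ge) (auto simp: finite_underS)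

lemma under_max_le: "(\<And>b. b \<in> underS r a \<Longrightarrow> f b \<le> m) \<Longrightarrow> under_max r f a \<le> m"
  unfolding under_max_def by (subst Max_le_iff) (auto simp: finite_underS)

lemma under_max_le_monotone:
  assumes "f \<in> monotone_maps Q r N" "a \<in> Q"
  shows "under_max r f a \<le> f a"
proof (rule under_max_le)
  fix b assume "b \<in> underS r a"
  moreover from this have "b \<in> Q" using underS_subset by blast
  ultimately show "f b \<le> f a" using assms unfolding monotone_maps_def underS_def by blast
qed

text \<open>The values of \<open>f\<close> are recovered from below: once \<open>f\<close> is known
  under \<open>a\<close>, adding the maximum there to the transferred value gives
  \<open>f a\<close>. Monotonicity ensures that the truncated subtraction has lost nothing.\<close>

lemma inj_on_transfer: "inj_on (transfer Q r) (monotone_maps Q r N)"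
proof (rule inj_onI)
  fix f f' assume f: "f \<in> monotone_maps Q r N" and f': "f' \<in> monotone_maps Q r N"
    and eq: "transfer Q r f = transfer Q r f'"
  have "f a = f' a" if "a \<in> Q" for a
    using that
  proof (induction a rule: measure_induct_rule[where f="\<lambda>a. card (underS r a)"])
    case (less a)
    have "f b = f' b" if "b \<in> underS r a" for b
      using less.IH[OF card_underS_less[OF that]] underS_subset that by blast
    then have "under_max r f a = under_max r f' a"
      unfolding under_max_def by (metis image_cong)
    moreover have "f a - under_max r f a = f' a - under_max r f' a"
      using fun_cong[OF eq, of a] less.prems by (simp add: transfer_def)
    ultimately show ?case
      using under_max_le_monotone[OF f less.prems] under_max_le_monotone[OF f' less.prems] by linarith
  qed
  then show "f = f'"
    using f f' unfolding monotone_maps_def by (auto intro: PiE_ext)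
qed

text \<open>Peeling off the top \<open>c\<close> of the chain makes the sum telescope: the rest
  weighs at most \<open>under_max r f c\<close>, which \<open>transfer\<close> had subtracted from
  \<open>f c\<close>. The bound \<open>m\<close> varies so that the induction hypothesis can be used
  with this maximum.\<close>

lemma sum_transfer_chain_le:
  assumes f: "f \<in> monotone_maps Q r N"
  shows "finite C \<Longrightarrow> C \<subseteq> Q \<Longrightarrow> C \<in> Chains r \<Longrightarrow> (\<And>c. c \<in> C \<Longrightarrow> f c \<le> m) \<Longrightarrow> sum (transfer Q r f) C \<le> m"
proof (induction "card C" arbitrary: C m)
  case 0
  then show ?case by simp
next
  case (Suc n)
  then have "C \<noteq> {}" by auto
  then obtain c where c: "c \<in> C" "\<And>b. b \<in> C \<Longrightarrow> (b, c) \<in> r"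
    using finite_chain_has_top[OF partial_order_onD(3)[OF po] Suc.prems(1) _ Suc.prems(3)] by blast
  have cQ: "c \<in> Q" using c Suc.prems by blast
  have "sum (transfer Q r f) (C - {c}) \<le> under_max r f c"
  proof (rule Suc.hyps(1))
    show "n = card (C - {c})" using Suc.hyps(2) c(1) Suc.prems(1) by simp
    show "C - {c} \<in> Chains r" using Chains_subset[OF Suc.prems(3)] by blast
    show "f b \<le> under_max r f c" if "b \<in> C - {c}" for b
      using under_max_ge[of b c] c(2) that by (auto simp: underS_def)
  qed (use Suc.prems in auto)
  moreover have "sum (transfer Q r f) C = transfer Q r f c + sum (transfer Q r f) (C - {c})"
    using c(1) Suc.prems(1) by (rule sum.remove[rotated])
  moreover have "transfer Q r f c + under_max r f c = f c"
    using under_max_le_monotone[OF f cQ] cQ by (simp add: transfer_def)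
  ultimately show ?case using Suc.prems(4)[OF c(1)] by linarith
qed

text \<open>The inverse of the transfer map sends \<open>g\<close> to the largest \<open>g\<close>-weight of a chain in the down-set of \<open>a\<close>.\<close>

definition heaviest :: "('a \<Rightarrow> nat) \<Rightarrow> 'a \<Rightarrow> nat" where
  "heaviest g a = Max (sum g ` {C. C \<in> Chains r \<and> C \<subseteq> under r a})"

lemma under_subset: "under r a \<subseteq> Q"
  using partial_order_onD(1)[OF po] by (auto simp: under_def)

lemma finite_chains_under: "finite {C. C \<in> Chains r \<and> C \<subseteq> under r a}"
  by (rule finite_subset[of _ "Pow Q"]) (use under_subset finite_Q in auto)

lemma heaviest_ge: "C \<in> Chains r \<Longrightarrow> C \<subseteq> under r a \<Longrightarrow> sum g C \<le> heaviest g a"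
  unfolding heaviest_def by (rule Max_ge) (auto simp: finite_chains_under)

lemma heaviest_attained: "\<exists>C \<in> Chains r. C \<subseteq> under r a \<and> sum g C = heaviest g a"
proof -
  have "{} \<in> Chains r" by (simp add: Chains_def)
  then have "heaviest g a \<in> sum g ` {C. C \<in> Chains r \<and> C \<subseteq> under r a}"
    unfolding heaviest_def by (intro Max_in) (use finite_chains_under in auto)
  then show ?thesis by auto
qed

text \<open>A heaviest chain under \<open>a\<close>, deprived of \<open>a\<close>, lies under its
  own top, which is strictly below \<open>a\<close>; conversely \<open>a\<close> can be put on top
  of any chain under a smaller element. The equation says that transferring
  \<open>heaviest g\<close> gives back \<open>g\<close>.\<close>

lemma heaviest_rec:
  assumes a: "a \<in> Q"
  shows "heaviest g a = g a + under_max r (heaviest g) a"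
proof (rule antisym)
  obtain C where C: "C \<in> Chains r" "C \<subseteq> under r a" "sum g C = heaviest g a"
    using heaviest_attained by blast
  have fin: "finite C" using C(2) under_subset finite_Q by (meson finite_subset)
  have "sum g (C - {a}) \<le> under_max r (heaviest g) a"
  proof (cases "C - {a} = {}")
    case False
    have ch: "C - {a} \<in> Chains r" using Chains_subset[OF C(1)] by blast
    obtain c where c: "c \<in> C - {a}" "\<And>b. b \<in> C - {a} \<Longrightarrow> (b, c) \<in> r"
      using finite_chain_has_top[OF partial_order_onD(3)[OF po] _ False ch] fin by auto
    have "sum g (C - {a}) \<le> heaviest g c"
      by (rule heaviest_ge[OF ch]) (use c in \<open>auto simp: under_def\<close>)
    also have "\<dots> \<le> under_max r (heaviest g) a"
      by (rule under_max_ge) (use c(1) C(2) in \<open>auto simp: underS_def under_def\<close>)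
    finally show ?thesis .
  qed (metis sum.empty zero_le)
  moreover have "sum g C \<le> g a + sum g (C - {a})"
    using fin by (cases "a \<in> C") (simp_all add: sum.remove)
  ultimately show "heaviest g a \<le> g a + under_max r (heaviest g) a" using C(3) by linarith
next
  have aa: "(a, a) \<in> r" using partial_order_onD(2)[OF po a] .
  \<comment> \<open>This keeps the subtraction of naturals in the next bound exact when it is undone
    at the end.\<close>
  have ga: "g a \<le> heaviest g a"
    using heaviest_ge[of "{a}" a g] aa by (simp add: Chains_def under_def)
  have "heaviest g b \<le> heaviest g a - g a" if b: "b \<in> underS r a" for b
  proof -
    obtain C where C: "C \<in> Chains r" "C \<subseteq> under r b" "sum g C = heaviest g b"
      using heaviest_attained by blast
    have fin: "finite C" using C(2) under_subset finite_Q by (meson finite_subset)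
    have below: "(c, a) \<in> r" if "c \<in> C" for c
      using C(2) b that transD[OF partial_order_onD(3)[OF po], of c b a] by (auto simp: underS_def under_def)
    have "a \<notin> C"
      using C(2) b partial_order_onD(4)[OF po] by (auto simp: under_def underS_def antisym_def)
    then have "g a + heaviest g b = sum g (insert a C)" using fin C(3) by simp
    also have "\<dots> \<le> heaviest g a"
      by (rule heaviest_ge[OF Chains_insert_above[OF C(1) aa]]) (use below aa in \<open>auto simp: under_def\<close>)
    finally show ?thesis by linarith
  qed
  then have "under_max r (heaviest g) a \<le> heaviest g a - g a" by (rule under_max_le)
  then show "g a + under_max r (heaviest g) a \<le> heaviest g a" using ga by linarith
qed

text \<open>The chain sums of a transferred map are bounded by its largest value on the chain, hence
  by \<open>k\<close>. For surjectivity, \<open>heaviest_rec\<close> shows both that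
  \<open>heaviest g\<close> is monotone and that it is mapped to \<open>g\<close>; its values are
  chain sums of \<open>g\<close>, hence at most \<open>k\<close>.\<close>

lemma bij_betw_transfer:
  "bij_betw (transfer Q r) (monotone_maps Q r {0..k}) (chain_bounded_maps Q r 0 k)"
  unfolding bij_betw_def
proof (intro conjI inj_on_transfer set_eqI iffI)
  fix g assume "g \<in> transfer Q r ` monotone_maps Q r {0..k}"
  then obtain f where f: "f \<in> monotone_maps Q r {0..k}" and g: "g = transfer Q r f" by blast
  have "sum g C \<le> k" if "C \<subseteq> Q" "C \<in> Chains r" for C
    unfolding g
  proof (rule sum_transfer_chain_le[OF f _ that])
    show "finite C" using that(1) finite_Q by (rule finite_subset)
    show "f c \<le> k" if "c \<in> C" for c
      using f that \<open>C \<subseteq> Q\<close> by (auto simp: monotone_maps_def)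
  qed
  moreover have "g \<in> Q \<rightarrow>\<^sub>E {0..}" unfolding g transfer_def by auto
  ultimately show "g \<in> chain_bounded_maps Q r 0 k"
    by (auto simp: chain_bounded_maps_def chain_bounded_def)
next
  fix g assume g: "g \<in> chain_bounded_maps Q r 0 k"
  define f where "f = (\<lambda>a\<in>Q. heaviest g a)"
  have um: "under_max r f a = under_max r (heaviest g) a" for a
  proof -
    have "f ` underS r a = heaviest g ` underS r a"
      by (rule image_cong[OF refl]) (use underS_subset in \<open>auto simp: f_def\<close>)
    then show ?thesis by (simp add: under_max_def)
  qed
  have "heaviest g a \<le> k" if "a \<in> Q" for a
  proof -
    obtain C where "C \<in> Chains r" "C \<subseteq> under r a" "sum g C = heaviest g a"
      using heaviest_attained by blast
    then show ?thesis
      using g chain_boundedD[of Q r k g C] under_subset[of a] by (auto simp: chain_bounded_maps_def)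
  qed
  moreover have "heaviest g a \<le> heaviest g b" if "(a, b) \<in> r" "b \<in> Q" for a b
  proof (cases "a = b")
    case False
    then have "heaviest g a \<le> under_max r (heaviest g) b"
      using that by (intro under_max_ge) (simp add: underS_def)
    then show ?thesis using heaviest_rec[OF that(2), of g] by linarith
  qed simp
  ultimately have "f \<in> monotone_maps Q r {0..k}"
    unfolding monotone_maps_def f_def by auto
  moreover have "g = transfer Q r f"
  proof
    fix a show "g a = transfer Q r f a"
      using g heaviest_rec[of a g] um
      by (cases "a \<in> Q") (auto simp: transfer_def f_def chain_bounded_maps_def)
  qed
  ultimately show "g \<in> transfer Q r ` monotone_maps Q r {0..k}" by blast
qed

text \<open>A positive transferred value at \<open>a\<close> means that \<open>f a\<close> exceeds
  every value strictly below and also the inserted 0. The latter removes 0 from the range, so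
  exactly \<open>k\<close> values remain.\<close>

lemma transfer_positive_iff:
  assumes f: "f \<in> monotone_maps Q r {0..k}"
  shows "transfer Q r f \<in> chain_bounded_maps Q r 1 k \<longleftrightarrow> f \<in> strict_monotone_maps Q r {1..k}"
proof -
  have "transfer Q r f \<in> chain_bounded_maps Q r 0 k"
    using bij_betw_apply[OF bij_betw_transfer f] .
  then have "transfer Q r f \<in> chain_bounded_maps Q r 1 k \<longleftrightarrow> (\<forall>a\<in>Q. 1 \<le> transfer Q r f a)"
    unfolding chain_bounded_maps_def PiE_iff by auto
  also have "\<dots> \<longleftrightarrow> (\<forall>a\<in>Q. under_max r f a < f a)"
    by (auto simp: transfer_def Suc_le_eq)
  also have "\<dots> \<longleftrightarrow> (\<forall>a\<in>Q. 0 < f a \<and> (\<forall>b\<in>underS r a. f b < f a))"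
    unfolding under_max_def by (subst Max_less_iff) (auto simp: finite_underS)
  also have "\<dots> \<longleftrightarrow> f \<in> strict_monotone_maps Q r {1..k}"
  proof -
    have "(\<forall>b\<in>underS r a. f b < f a) \<longleftrightarrow> (\<forall>b\<in>Q. (b, a) \<in> r \<and> b \<noteq> a \<longrightarrow> f b < f a)" for a
      using underS_subset[of a] by (auto simp: underS_def)
    then show ?thesis
      using f unfolding monotone_maps_def strict_monotone_maps_def PiE_iff
      by (auto simp: Suc_le_eq)
  qed
  finally show ?thesis .
qed

lemma card_chain_bounded_maps_1:
  "card (chain_bounded_maps Q r 1 k) = strict_order_poly Q r k"
proof -
  have sub: "strict_monotone_maps Q r {1..k} \<subseteq> monotone_maps Q r {0..k}"
  proof
    fix f assume f: "f \<in> strict_monotone_maps Q r {1..k}"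
    then have "f a \<le> f b" if "a \<in> Q" "b \<in> Q" "(a, b) \<in> r" for a b
      using that by (cases "a = b") (auto simp: strict_monotone_maps_def less_imp_le)
    moreover have "f \<in> Q \<rightarrow>\<^sub>E {0..k}" using f by (auto simp: strict_monotone_maps_def)
    ultimately show "f \<in> monotone_maps Q r {0..k}" by (simp add: monotone_maps_def)
  qed
  have "transfer Q r ` strict_monotone_maps Q r {1..k} = chain_bounded_maps Q r 1 k"
  proof (intro set_eqI iffI)
    fix g assume "g \<in> chain_bounded_maps Q r 1 k"
    moreover from this have "g \<in> chain_bounded_maps Q r 0 k" by (auto simp: chain_bounded_maps_def)
    moreover from this obtain f where "f \<in> monotone_maps Q r {0..k}" "g = transfer Q r f"
      using bij_betw_transfer[of k] unfolding bij_betw_def by blast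
    ultimately show "g \<in> transfer Q r ` strict_monotone_maps Q r {1..k}"
      using transfer_positive_iff[of f k] by blast
  next
    fix g assume "g \<in> transfer Q r ` strict_monotone_maps Q r {1..k}"
    then obtain f where "f \<in> strict_monotone_maps Q r {1..k}" "g = transfer Q r f" by blast
    then show "g \<in> chain_bounded_maps Q r 1 k" using transfer_positive_iff[of f k] sub by blast
  qed
  moreover have "inj_on (transfer Q r) (strict_monotone_maps Q r {1..k})"
    using inj_on_transfer sub by (rule inj_on_subset)
  ultimately have "card (strict_monotone_maps Q r {1..k}) = card (chain_bounded_maps Q r 1 k)"
    by (metis card_image)
  then show ?thesis by (simp add: strict_order_poly_def strict_monotone_maps_def)
qed

lemma card_chain_bounded_maps_0:
  "card (chain_bounded_maps Q r 0 k) = order_poly Q r (Suc k)"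
proof -
  \<comment> \<open>Weak maps keep the value 0, so their range has \<open>k + 1\<close> elements;
    shifting it to start at 1 gives the argument \<open>Suc k\<close> of the order
    polynomial.\<close>
  have "bij_betw (\<lambda>f. \<lambda>a\<in>Q. Suc (f a)) (monotone_maps Q r {0..k}) (monotone_maps Q r {1..Suc k})"
  proof (rule bij_betw_byWitness[where f'="\<lambda>f. \<lambda>a\<in>Q. f a - 1"])
    show "\<forall>f\<in>monotone_maps Q r {0..k}. (\<lambda>a\<in>Q. (\<lambda>a\<in>Q. Suc (f a)) a - 1) = f"
      by (auto simp: monotone_maps_def PiE_iff extensional_def fun_eq_iff)
    show "\<forall>f\<in>monotone_maps Q r {1..Suc k}. (\<lambda>a\<in>Q. Suc ((\<lambda>a\<in>Q. f a - 1) a)) = f"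
      by (auto simp: monotone_maps_def PiE_iff extensional_def fun_eq_iff)
    show "(\<lambda>f. \<lambda>a\<in>Q. Suc (f a)) ` monotone_maps Q r {0..k} \<subseteq> monotone_maps Q r {1..Suc k}"
      by (auto simp: monotone_maps_def PiE_iff)
    show "(\<lambda>f. \<lambda>a\<in>Q. f a - 1) ` monotone_maps Q r {1..Suc k} \<subseteq> monotone_maps Q r {0..k}"
      by (auto simp: monotone_maps_def PiE_iff intro!: diff_le_mono)
  qed
  then have "card (monotone_maps Q r {0..k}) = order_poly Q r (Suc k)"
    unfolding order_poly_def by (simp add: bij_betw_same_card monotone_maps_def)
  then show ?thesis using bij_betw_same_card[OF bij_betw_transfer[of k]] by simp
qed

lemma finite_chain_bounded_maps: "finite (chain_bounded_maps Q r s k)"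
proof (rule finite_subset)
  show "chain_bounded_maps Q r s k \<subseteq> Q \<rightarrow>\<^sub>E {0..k}"
  proof
    fix g assume g: "g \<in> chain_bounded_maps Q r s k"
    then have "g a \<le> k" if "a \<in> Q" for a
      using chain_bounded_singletonD[OF po, of k g] that by (simp add: chain_bounded_maps_def)
    then show "g \<in> Q \<rightarrow>\<^sub>E {0..k}" using g by (simp add: chain_bounded_maps_def PiE_iff)
  qed
qed (simp add: finite_PiE finite_Q)

end

section \<open>Asymptotics of order polynomials\<close>

lemma linear_order_onD:
  assumes "linear_order_on Q l"
  shows "partial_order_on Q l" "\<And>a b. a \<in> Q \<Longrightarrow> b \<in> Q \<Longrightarrow> (a, b) \<in> l \<or> (b, a) \<in> l"
proof -
  show po: "partial_order_on Q l" using assms by (simp add: linear_order_on_def)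
  show "(a, b) \<in> l \<or> (b, a) \<in> l" if "a \<in> Q" "b \<in> Q" for a b
    using assms that partial_order_onD(2)[OF po]
    by (cases "a = b") (auto simp: linear_order_on_def total_on_def)
qed

section \<open>Strict maps on a linear order\<close>

context
  fixes Q :: "'a set" and l :: "'a rel"
  assumes finite_Q: "finite Q" and lin: "linear_order_on Q l"
begin

lemma strict_monotone_maps_linear_less_iff:
  assumes f: "f \<in> strict_monotone_maps Q l N" and "a \<in> Q" "b \<in> Q"
  shows "f a < f b \<longleftrightarrow> a \<in> underS l b"
proof
  assume less: "f a < f b"
  then have "a \<noteq> b" by auto
  moreover have "(b, a) \<notin> l"
  proof
    assume "(b, a) \<in> l"
    then have "f b < f a" using f assms(2,3) \<open>a \<noteq> b\<close> by (simp add: strict_monotone_maps_def)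
    then show False using less by simp
  qed
  ultimately show "a \<in> underS l b"
    using linear_order_onD(2)[OF lin assms(2,3)] by (auto simp: underS_def)
next
  assume "a \<in> underS l b"
  then show "f a < f b" using f assms(2,3) by (auto simp: strict_monotone_maps_def underS_def)
qed

lemma strict_monotone_maps_linear_inj:
  assumes f: "f \<in> strict_monotone_maps Q l N"
  shows "inj_on f Q"
proof (rule inj_onI)
  fix a b assume ab: "a \<in> Q" "b \<in> Q" "f a = f b"
  then have "a \<notin> underS l b" "b \<notin> underS l a"
    using strict_monotone_maps_linear_less_iff[OF f, of a b]
      strict_monotone_maps_linear_less_iff[OF f, of b a] by simp_all
  then show "a = b" using linear_order_onD(2)[OF lin ab(1,2)] by (auto simp: underS_def)
qed

text \<open>A strictly monotone map on a linear order amounts to the choice of its image, a subset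
  of \<open>N\<close> of size \<open>card Q\<close>.\<close>

lemma card_strict_monotone_maps_linear:
  assumes "finite N"
  shows "card (strict_monotone_maps Q l N) = card N choose card Q"
proof -
  note po = linear_order_onD(1)[OF lin]
  have inj: "inj_on (\<lambda>f. f ` Q) (strict_monotone_maps Q l N)"
  proof (rule inj_onI)
    fix f f' assume f: "f \<in> strict_monotone_maps Q l N" and f': "f' \<in> strict_monotone_maps Q l N"
      and eq: "f ` Q = f' ` Q"
    \<comment> \<open>The position of \<open>h a\<close> within the image is the rank of
      \<open>a\<close>, whatever \<open>h\<close> is; so two maps with the same image agree.\<close>
    have rank: "card {s \<in> h ` Q. s < h a} = card (underS l a)"
      if h: "h \<in> strict_monotone_maps Q l N" and a: "a \<in> Q" for h a
    proof -
      have sub: "underS l a \<subseteq> Q" by (rule underS_subset[OF finite_Q po])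
      have "{s \<in> h ` Q. s < h a} = h ` underS l a"
        using sub strict_monotone_maps_linear_less_iff[OF h _ a] by auto
      then show ?thesis
        using inj_on_subset[OF strict_monotone_maps_linear_inj[OF h] sub] by (simp add: card_image)
    qed
    have not_less: "\<not> s < t"
      if "s \<in> S" "t \<in> S" "card {x \<in> S. x < s} = card {x \<in> S. x < t}" "finite S" for s t :: nat and S
    proof
      assume "s < t"
      then have "{x \<in> S. x < s} \<subset> {x \<in> S. x < t}" using that(1) by auto
      then have "card {x \<in> S. x < s} < card {x \<in> S. x < t}"
        by (rule psubset_card_mono[rotated]) (simp add: that(4))
      then show False using that(3) by simp
    qed
    have "f a = f' a" if a: "a \<in> Q" for a
    proof -
      have "card {x \<in> f ` Q. x < f a} = card {x \<in> f ` Q. x < f' a}"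
        using rank[OF f a] rank[OF f' a] eq by simp
      moreover have "f a \<in> f ` Q" "f' a \<in> f ` Q" "finite (f ` Q)" using a eq finite_Q by auto
      ultimately show ?thesis
        using not_less[of "f a" "f ` Q" "f' a"] not_less[of "f' a" "f ` Q" "f a"] by simp
    qed
    then show "f = f'" using f f' by (auto simp: strict_monotone_maps_def intro: PiE_ext)
  qed
  have "(\<lambda>f. f ` Q) ` strict_monotone_maps Q l N = {S. S \<subseteq> N \<and> card S = card Q}"
  proof (intro set_eqI iffI)
    fix S assume "S \<in> (\<lambda>f. f ` Q) ` strict_monotone_maps Q l N"
    then obtain f where f: "f \<in> strict_monotone_maps Q l N" "S = f ` Q" by blast
    then have "card S = card Q" by (simp add: card_image strict_monotone_maps_linear_inj)
    then show "S \<in> {S. S \<subseteq> N \<and> card S = card Q}"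
      using f by (auto simp: strict_monotone_maps_def)
  next
    fix S assume "S \<in> {S. S \<subseteq> N \<and> card S = card Q}"
    then have S: "S \<subseteq> N" "card S = card Q" "finite S" using assms finite_subset by auto
    define xs where "xs = sorted_list_of_set S"
    have xs: "length xs = card Q" "sorted_wrt (<) xs" "set xs = S" using S by (auto simp: xs_def)
    have rank_less: "card (underS l a) < length xs" if "a \<in> Q" for a
    proof -
      have "a \<notin> underS l a" by (simp add: underS_def)
      then have "underS l a \<subset> Q" using underS_subset[OF finite_Q po, of a] that by blast
      then show ?thesis using xs(1) finite_Q by (simp add: psubset_card_mono)
    qed
    \<comment> \<open>The number of strictly smaller elements is a rank counted from 0, as are the
      indices of the sorted list.\<close>
    define f where "f = (\<lambda>a\<in>Q. xs ! card (underS l a))"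
    have "f a \<in> S" if "a \<in> Q" for a
      using nth_mem[OF rank_less[OF that]] xs(3) that by (simp add: f_def)
    moreover have "f a < f b" if "a \<in> Q" "b \<in> Q" "(a, b) \<in> l" "a \<noteq> b" for a b
    proof -
      have "card (underS l a) < card (underS l b)"
        by (rule card_underS_less[OF finite_Q po]) (use that in \<open>simp add: underS_def\<close>)
      then show ?thesis
        using sorted_wrt_nth_less[OF xs(2) _ rank_less[OF that(2)]] that by (simp add: f_def)
    qed
    ultimately have f: "f \<in> strict_monotone_maps Q l N" and "f ` Q \<subseteq> S"
      using S(1) by (auto simp: strict_monotone_maps_def f_def)
    moreover have "card (f ` Q) = card S"
      using S(2) by (simp add: card_image strict_monotone_maps_linear_inj[OF f])
    ultimately have "f ` Q = S" using S(3) by (simp add: card_subset_eq)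
    then show "S \<in> (\<lambda>f. f ` Q) ` strict_monotone_maps Q l N" using f by blast
  qed
  then show ?thesis using card_image[OF inj] n_subsets[OF assms, of "card Q"] by simp
qed

end

section \<open>Injective monotone maps and linear extensions\<close>

lemma finite_lin_exts: "finite Q \<Longrightarrow> finite {l. linear_order_on Q l \<and> r \<subseteq> l}"
  by (rule finite_subset[of _ "Pow (Q \<times> Q)"])
    (auto simp: linear_order_on_def partial_order_on_def preorder_on_def)

lemma finite_monotone_maps: "finite Q \<Longrightarrow> finite N \<Longrightarrow> finite (monotone_maps Q r N)"
  by (simp add: monotone_maps_def finite_PiE)

lemma finite_strict_monotone_maps: "finite Q \<Longrightarrow> finite N \<Longrightarrow> finite (strict_monotone_maps Q r N)"
  by (simp add: strict_monotone_maps_def finite_PiE)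

text \<open>An injective order-preserving map pulls back the order of the integers to a linear extension.\<close>

lemma inj_monotone_maps_eq:
  assumes po: "partial_order_on Q r"
  shows "{f \<in> monotone_maps Q r N. inj_on f Q} =
    (\<Union>l \<in> {l. linear_order_on Q l \<and> r \<subseteq> l}. {f \<in> strict_monotone_maps Q l N. inj_on f Q})"
proof (intro set_eqI iffI)
  fix f assume "f \<in> {f \<in> monotone_maps Q r N. inj_on f Q}"
  then have f: "f \<in> monotone_maps Q r N" "inj_on f Q" by auto
  define l where "l = {(a, b). a \<in> Q \<and> b \<in> Q \<and> f a \<le> f b}"
  have "linear_order_on Q l"
    using f(2) unfolding linear_order_on_def partial_order_on_def preorder_on_def l_def
    by (auto simp: refl_on_def trans_def antisym_def total_on_def inj_on_def)
  moreover have "r \<subseteq> l"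
    using f(1) partial_order_onD(1)[OF po] by (auto simp: l_def monotone_maps_def)
  moreover have "f \<in> strict_monotone_maps Q l N"
    using f by (auto simp: l_def monotone_maps_def strict_monotone_maps_def inj_on_def order.strict_iff_order)
  ultimately show "f \<in> (\<Union>l \<in> {l. linear_order_on Q l \<and> r \<subseteq> l}. {f \<in> strict_monotone_maps Q l N. inj_on f Q})"
    using f by blast
next
  fix f assume "f \<in> (\<Union>l \<in> {l. linear_order_on Q l \<and> r \<subseteq> l}. {f \<in> strict_monotone_maps Q l N. inj_on f Q})"
  then obtain l where l: "r \<subseteq> l" and f: "f \<in> strict_monotone_maps Q l N" "inj_on f Q" by blast
  have "f a \<le> f b" if "a \<in> Q" "b \<in> Q" "(a, b) \<in> r" for a b
    using that l f(1) by (cases "a = b") (auto simp: strict_monotone_maps_def less_imp_le)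
  then show "f \<in> {f \<in> monotone_maps Q r N. inj_on f Q}"
    using f by (simp add: monotone_maps_def strict_monotone_maps_def)
qed

text \<open>Every linear extension contributes one binomial, and none of its maps is counted twice:
  a map determines the linear order for which it is strict, by comparing its values.\<close>

lemma card_inj_monotone_maps:
  assumes fin: "finite Q" and po: "partial_order_on Q r" and N: "finite N"
  shows "card {f \<in> monotone_maps Q r N. inj_on f Q} = num_lin_ext Q r * (card N choose card Q)"
proof -
  let ?L = "{l. linear_order_on Q l \<and> r \<subseteq> l}"
  have "{f \<in> monotone_maps Q r N. inj_on f Q} = (\<Union>l \<in> ?L. strict_monotone_maps Q l N)"
    unfolding inj_monotone_maps_eq[OF po]
    by (rule SUP_cong[OF refl]) (use strict_monotone_maps_linear_inj[OF fin] in auto)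
  also have "card \<dots> = (\<Sum>l\<in>?L. card (strict_monotone_maps Q l N))"
  proof (rule card_UN_disjoint[OF finite_lin_exts[OF fin]])
    show "\<forall>l\<in>?L. finite (strict_monotone_maps Q l N)" using finite_strict_monotone_maps[OF fin N] by blast
    show "\<forall>l\<in>?L. \<forall>l'\<in>?L. l \<noteq> l' \<longrightarrow> strict_monotone_maps Q l N \<inter> strict_monotone_maps Q l' N = {}"
    proof (intro ballI impI)
      fix l l' assume l: "l \<in> ?L" "l' \<in> ?L" "l \<noteq> l'"
      have "l = l'" if f: "f \<in> strict_monotone_maps Q l N" and f': "f \<in> strict_monotone_maps Q l' N" for f
      proof -
        have char: "(a, b) \<in> m \<longleftrightarrow> a \<in> Q \<and> b \<in> Q \<and> (a = b \<or> f a < f b)"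
          if m: "linear_order_on Q m" and "f \<in> strict_monotone_maps Q m N" for m a b
          using strict_monotone_maps_linear_less_iff[OF fin that, of a b]
            partial_order_onD(1,2)[OF linear_order_onD(1)[OF m]]
          by (auto simp: underS_def)
        have "(a, b) \<in> l \<longleftrightarrow> (a, b) \<in> l'" for a b
          using char[OF _ f, of a b] char[OF _ f', of a b] l by simp
        then show ?thesis by auto
      qed
      then show "strict_monotone_maps Q l N \<inter> strict_monotone_maps Q l' N = {}" using l(3) by blast
    qed
  qed
  also have "\<dots> = (\<Sum>l\<in>?L. card N choose card Q)"
    by (rule sum.cong[OF refl]) (simp add: card_strict_monotone_maps_linear[OF fin _ N])
  also have "\<dots> = num_lin_ext Q r * (card N choose card Q)" by (simp add: num_lin_ext_def)
  finally show ?thesis .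
qed

section \<open>Bounds for order polynomials and their leading coefficient\<close>

lemma strict_order_poly_ge:
  assumes fin: "finite Q" and po: "partial_order_on Q r"
  shows "num_lin_ext Q r * (k choose card Q) \<le> strict_order_poly Q r k"
proof -
  have "{f \<in> monotone_maps Q r {1..k}. inj_on f Q} \<subseteq> strict_monotone_maps Q r {1..k}"
    by (auto simp: monotone_maps_def strict_monotone_maps_def inj_on_def order.strict_iff_order)
  then have "card {f \<in> monotone_maps Q r {1..k}. inj_on f Q} \<le> card (strict_monotone_maps Q r {1..k})"
    by (intro card_mono finite_strict_monotone_maps fin) auto
  then show ?thesis
    by (simp add: card_inj_monotone_maps[OF fin po] strict_order_poly_def strict_monotone_maps_def)
qed

lemma strict_order_poly_le_order_poly:
  assumes fin: "finite Q"
  shows "strict_order_poly Q r k \<le> order_poly Q r k"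
proof -
  have "strict_monotone_maps Q r {1..k} \<subseteq> monotone_maps Q r {1..k}"
    unfolding monotone_maps_def strict_monotone_maps_def by (auto simp: le_less)
  then show ?thesis
    unfolding order_poly_def strict_order_poly_def monotone_maps_def strict_monotone_maps_def
    by (intro card_mono) (auto simp: finite_PiE fin)
qed

lemma order_poly_mono:
  assumes fin: "finite Q" and "k \<le> k'"
  shows "order_poly Q r k \<le> order_poly Q r k'"
proof -
  have "monotone_maps Q r {1..k} \<subseteq> monotone_maps Q r {1..k'}"
    using assms(2) by (auto simp: monotone_maps_def PiE_iff)
  then show ?thesis
    unfolding order_poly_def monotone_maps_def[symmetric]
    by (intro card_mono finite_monotone_maps fin) simp_all
qed

text \<open>The falling factorial, which counts injective maps. It also covers \<open>k < d\<close>: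
  the factor at \<open>i = k\<close> is then 0, like the binomial.\<close>

lemma prod_diff_eq_fact_mult_binomial:
  fixes k d :: nat
  shows "(\<Prod>i=0..<d. k - i) = fact d * (k choose d)"
proof (induction d)
  case (Suc d)
  have "(\<Prod>i=0..<Suc d. k - i) = fact d * ((k - d) * (k choose d))" using Suc by simp
  also have "(k - d) * (k choose d) = Suc d * (k choose Suc d)"
    by (simp only: binomial_absorb_comp binomial_absorption)
  finally show ?case by (simp add: algebra_simps)
qed simp

text \<open>Monotone maps that are not injective are bounded crudely by all maps that are not
  injective. Their number, the last bracket, is of order below \<open>k ^ card Q\<close> and does
  not affect the leading coefficient.\<close>

lemma order_poly_le:
  assumes fin: "finite Q" and po: "partial_order_on Q r"
  shows "real (order_poly Q r k) \<le>
    real (num_lin_ext Q r * (k choose card Q)) + (real k ^ card Q - fact (card Q) * real (k choose card Q))"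
proof -
  let ?I = "{f \<in> monotone_maps Q r {1..k}. inj_on f Q}"
  let ?F = "Q \<rightarrow>\<^sub>E {1..k}" and ?J = "{f \<in> Q \<rightarrow>\<^sub>E {1..k}. inj_on f Q}"
  have finF: "finite ?F" by (simp add: finite_PiE fin)
  have "card ?J = (\<Prod>i=0..<card Q. k - i)"
    using card_inj_on_subset_funcset[OF fin, of "{1..k}" Q] by simp
  also have "\<dots> = fact (card Q) * (k choose card Q)"
    by (rule prod_diff_eq_fact_mult_binomial)
  finally have J: "card ?J = fact (card Q) * (k choose card Q)" .
  have "monotone_maps Q r {1..k} \<subseteq> ?I \<union> (?F - ?J)" by (auto simp: monotone_maps_def)
  then have "order_poly Q r k \<le> card (?I \<union> (?F - ?J))"
    unfolding order_poly_def monotone_maps_def[symmetric]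
    by (rule card_mono[rotated]) (use finite_monotone_maps[OF fin] finF in auto)
  also have "\<dots> \<le> card ?I + card (?F - ?J)" by (rule card_Un_le)
  also have "card (?F - ?J) = card ?F - card ?J"
  proof (rule card_Diff_subset)
    show "finite ?J" using finF by (rule rev_finite_subset) auto
  qed auto
  finally have "real (order_poly Q r k) \<le> real (card ?I + (card ?F - card ?J))"
    by (rule of_nat_mono)
  moreover have "card ?J \<le> card ?F" by (rule card_mono[OF finF]) auto
  moreover have "card ?F = k ^ card Q" by (simp add: card_funcsetE fin)
  ultimately show ?thesis
    using J card_inj_monotone_maps[OF fin po, of "{1..k}"] by (simp add: of_nat_diff)
qed

lemma binomial_over_power_tendsto:
  "(\<lambda>k. real (k choose d) / real k ^ d) \<longlonglongrightarrow> 1 / fact d"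
proof -
  have "(\<lambda>k. (\<Prod>i=0..<d. (real k - real i) / real k) / fact d) \<longlonglongrightarrow> (\<Prod>i=0..<d. 1) / fact d"
    by (intro tendsto_divide tendsto_prod tendsto_const) (simp, real_asymp, simp)
  moreover have "(\<Prod>i=0..<d. (real k - real i) / real k) / fact d = real (k choose d) / real k ^ d" for k
    by (simp add: binomial_gbinomial gbinomial_prod_rev prod_dividef)
  ultimately show ?thesis by simp
qed

text \<open>One squeeze serves both limits: the weak count at \<open>Suc k\<close> dominates the
  strict count at \<open>k\<close>, so the lower bound of the latter and the upper bound of the
  former enclose both.\<close>

lemma strict_order_poly_tendsto:
  assumes fin: "finite Q" and po: "partial_order_on Q r"
  shows "(\<lambda>k. real (strict_order_poly Q r k) / real k ^ card Q) \<longlonglongrightarrow> num_lin_ext Q r / fact (card Q)"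
    and order_poly_Suc_tendsto:
     "(\<lambda>k. real (order_poly Q r (Suc k)) / real k ^ card Q) \<longlonglongrightarrow> num_lin_ext Q r / fact (card Q)"
proof -
  let ?d = "card Q" and ?e = "real (num_lin_ext Q r)"
  let ?b = "\<lambda>k. real (k choose ?d) / real k ^ ?d"
  define lo where "lo k = ?e * ?b k" for k
  \<comment> \<open>The bracket is the upper bound at \<open>Suc k\<close> divided by the power of
    \<open>Suc k\<close>; the last factor, tending to 1, converts this to division by the power of
    \<open>k\<close>.\<close>
  define hi where "hi k = (?e * ?b (Suc k) + (1 - fact ?d * ?b (Suc k))) * (real (Suc k) / real k) ^ ?d" for k
  have lo_lim: "lo \<longlonglongrightarrow> ?e / fact ?d"
    using tendsto_mult[OF tendsto_const binomial_over_power_tendsto, of ?e ?d] by (simp add: lo_def[abs_def])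
  have "(\<lambda>k. real (Suc k) / real k) \<longlonglongrightarrow> 1" by real_asymp
  then have "hi \<longlonglongrightarrow> (?e * (1 / fact ?d) + (1 - fact ?d * (1 / fact ?d))) * 1 ^ ?d"
    unfolding hi_def[abs_def]
    by (intro tendsto_intros LIMSEQ_Suc[OF binomial_over_power_tendsto])
  then have hi_lim: "hi \<longlonglongrightarrow> ?e / fact ?d" by simp
  have lo: "lo k \<le> real (strict_order_poly Q r k) / real k ^ ?d" for k
  proof -
    have "?e * real (k choose ?d) \<le> real (strict_order_poly Q r k)"
      using strict_order_poly_ge[OF fin po, of k] by (metis of_nat_le_iff of_nat_mult)
    then show ?thesis unfolding lo_def by (simp add: divide_right_mono)
  qed
  have mid: "real (strict_order_poly Q r k) / real k ^ ?d \<le> real (order_poly Q r (Suc k)) / real k ^ ?d" for k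
    using strict_order_poly_le_order_poly[OF fin, of r k] order_poly_mono[OF fin, of k "Suc k" r]
    by (intro divide_right_mono) auto
  have hi: "real (order_poly Q r (Suc k)) / real k ^ ?d \<le> hi k" if "k \<ge> 1" for k
  proof -
    define S where "S = real (Suc k) ^ ?d"
    define K where "K = real k ^ ?d"
    have "S > 0" "K > 0" using that by (simp_all add: S_def K_def)
    have "real (order_poly Q r (Suc k)) / real k ^ ?d \<le>
      (?e * real (Suc k choose ?d) + (S - fact ?d * real (Suc k choose ?d))) / real k ^ ?d"
      using order_poly_le[OF fin po, of "Suc k"] unfolding S_def of_nat_mult
      by (intro divide_right_mono) simp_all
    also have "\<dots> = hi k"
      using \<open>S > 0\<close> \<open>K > 0\<close> unfolding hi_def power_divide S_def[symmetric] K_def[symmetric]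
      by (simp add: field_simps)
    finally show ?thesis .
  qed
  have lo': "eventually (\<lambda>k. lo k \<le> real (order_poly Q r (Suc k)) / real k ^ ?d) sequentially"
    using order_trans[OF lo mid] by (rule always_eventually[OF allI])
  have hi': "eventually (\<lambda>k. real (order_poly Q r (Suc k)) / real k ^ ?d \<le> hi k) sequentially"
    using hi by (rule eventually_sequentiallyI)
  have hi'': "eventually (\<lambda>k. real (strict_order_poly Q r k) / real k ^ ?d \<le> hi k) sequentially"
    using order_trans[OF mid hi] by (rule eventually_sequentiallyI)
  show "(\<lambda>k. real (strict_order_poly Q r k) / real k ^ ?d) \<longlonglongrightarrow> ?e / fact ?d"
    by (rule tendsto_sandwich[OF always_eventually[OF allI[OF lo]] hi'' lo_lim hi_lim])
  show "(\<lambda>k. real (order_poly Q r (Suc k)) / real k ^ ?d) \<longlonglongrightarrow> ?e / fact ?d"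
    by (rule tendsto_sandwich[OF lo' hi' lo_lim hi_lim])
qed

section \<open>Chain polytopes as convex hulls\<close>

lemma mem_chain_polytope_iff:
  "g \<in> chain_polytope P r \<longleftrightarrow>
    (\<forall>a\<in>P. 0 \<le> g a) \<and> (\<forall>a. a \<notin> P \<longrightarrow> g a = 0) \<and> chain_bounded P r 1 g"
  by (simp add: chain_polytope_def chain_bounded_def)

definition antichains :: "'a set \<Rightarrow> 'a rel \<Rightarrow> 'a set set" where
  "antichains P r = {A. A \<subseteq> P \<and> (\<forall>a\<in>A. \<forall>b\<in>A. (a, b) \<in> r \<longrightarrow> a = b)}"

definition antichain_vertices :: "'a set \<Rightarrow> 'a rel \<Rightarrow> ('a \<Rightarrow> real) set" where
  "antichain_vertices P r = indicator ` antichains P r"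

lemma finite_antichain_vertices: "finite P \<Longrightarrow> finite (antichain_vertices P r)"
  unfolding antichain_vertices_def antichains_def by (intro finite_imageI) simp

lemma antichain_vertices_int_lattice: "antichain_vertices P r \<subseteq> int_lattice P"
  by (auto simp: antichain_vertices_def antichains_def int_lattice_def indicator_def)

text \<open>A chain and an antichain share at most one element.\<close>

lemma antichain_vertices_subset_chain_polytope:
  assumes "finite P"
  shows "antichain_vertices P r \<subseteq> chain_polytope P r"
proof
  fix g assume "g \<in> antichain_vertices P r"
  then obtain A where A: "A \<in> antichains P r" and g: "g = indicator A"
    by (auto simp: antichain_vertices_def)
  have "sum g C \<le> 1" if C: "C \<subseteq> P" "C \<in> Chains r" for C
  proof -
    have fin: "finite C" using C(1) assms by (rule finite_subset)
    have "card (C \<inter> A) \<le> 1"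
    proof (rule ccontr)
      assume "\<not> card (C \<inter> A) \<le> 1"
      then obtain a b where "a \<in> C \<inter> A" "b \<in> C \<inter> A" "a \<noteq> b"
        using card_le_Suc0_iff_eq[of "C \<inter> A"] fin by auto
      then show False using A C(2) unfolding antichains_def Chains_def by blast
    qed
    moreover have "sum g C = (\<Sum>a\<in>C \<inter> A. 1)"
      unfolding g by (rule sum.mono_neutral_cong_right) (auto simp: fin indicator_def)
    ultimately show ?thesis by simp
  qed
  then show "g \<in> chain_polytope P r"
    using A by (auto simp: mem_chain_polytope_iff chain_bounded_def g antichains_def indicator_def)
qed

lemma convex_chain_polytope: "convex (chain_polytope P r)"
proof (rule convexI)
  fix x y and u v :: real
  assume x: "x \<in> chain_polytope P r" and y: "y \<in> chain_polytope P r"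
    and uv: "0 \<le> u" "0 \<le> v" "u + v = 1"
  have "(\<Sum>a\<in>C. (u *\<^sub>R x + v *\<^sub>R y) a) \<le> 1" if "C \<subseteq> P" "C \<in> Chains r" for C
  proof -
    have "sum x C \<le> 1" "sum y C \<le> 1"
      using x y that by (auto simp: mem_chain_polytope_iff chain_bounded_def)
    then have "u * sum x C + v * sum y C \<le> u * 1 + v * 1"
      using uv by (intro add_mono mult_left_mono) auto
    then show ?thesis
      using uv by (simp add: scaleR_fun_def sum.distrib sum_distrib_left)
  qed
  then show "u *\<^sub>R x + v *\<^sub>R y \<in> chain_polytope P r"
    using x y uv by (auto simp: mem_chain_polytope_iff chain_bounded_def scaleR_fun_def)
qed

text \<open>Greedy decomposition: the minimal elements of the support of \<open>g\<close> form an antichain that can be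
  added to every chain avoiding it, so subtracting their least weight \<open>\<epsilon>\<close> from all of them lowers
  every chain sum bound by \<open>\<epsilon>\<close> and shrinks the support.\<close>

lemma antichain_decomposition:
  assumes fin: "finite P" and po: "partial_order_on P r"
  shows "(\<forall>a\<in>P. 0 \<le> g a) \<Longrightarrow> (\<forall>a. a \<notin> P \<longrightarrow> g a = 0) \<Longrightarrow> chain_bounded P r m g \<Longrightarrow>
    \<exists>v \<in> convex hull (antichain_vertices P r). g = m *\<^sub>R v"
\<comment> \<open>The bound \<open>m\<close> must vary with \<open>g\<close>: removing a multiple
  \<open>e\<close> of an antichain lowers it to \<open>m - e\<close>.\<close>
proof (induction "card {a \<in> P. g a \<noteq> 0}" arbitrary: g m rule: less_induct)
  case less
  let ?S = "{a \<in> P. g a \<noteq> 0}"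
  have finS: "finite ?S" using fin by simp
  have nonneg: "0 \<le> g a" for a using less.prems(1,2) by (cases "a \<in> P") auto
  show ?case
  proof (cases "?S = {}")
    \<comment> \<open>The empty antichain provides the origin, where the decomposition ends.\<close>
    case True
    then have "g = m *\<^sub>R indicator {}"
      using less.prems(2) by (auto simp: scaleR_fun_def fun_eq_iff)
    moreover have "indicator {} \<in> antichain_vertices P r"
      by (auto simp: antichain_vertices_def antichains_def)
    ultimately show ?thesis by (blast intro: hull_inc)
  next
    case False
    define A where "A = {a \<in> ?S. \<forall>b\<in>?S. (b, a) \<in> r \<longrightarrow> b = a}"
    have below: "\<exists>a\<in>A. (a, c) \<in> r" if "c \<in> ?S" for c
      using that
    proof (induction c rule: measure_induct_rule[where f="\<lambda>a. card (underS r a)"])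
      case (less c)
      show ?case
      proof (cases "c \<in> A")
        case True
        then show ?thesis using partial_order_onD(2)[OF po] less.prems by blast
      next
        case False
        then obtain b where b: "b \<in> ?S" "(b, c) \<in> r" "b \<noteq> c" using less.prems by (auto simp: A_def)
        then have "card (underS r b) < card (underS r c)"
          by (intro card_underS_less[OF fin po]) (simp add: underS_def)
        then obtain a where "a \<in> A" "(a, b) \<in> r" using less.IH b(1) by blast
        then show ?thesis using transD[OF partial_order_onD(3)[OF po] _ b(2)] by blast
      qed
    qed
    have AP: "A \<subseteq> ?S" by (auto simp: A_def)
    have finA: "finite A" using AP finS by (rule finite_subset)
    have neA: "A \<noteq> {}" using below False by blast
    have antiA: "A \<in> antichains P r" using AP by (auto simp: antichains_def A_def)
    define e where "e = Min (g ` A)"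
    have e_le: "e \<le> g a" if "a \<in> A" for a using finA that by (simp add: e_def)
    obtain a0 where a0: "a0 \<in> A" "g a0 = e"
      using Min_in[of "g ` A"] finA neA unfolding e_def by fastforce
    have e_pos: "e > 0" using a0 AP nonneg[of a0] by force
    \<comment> \<open>The singleton of \<open>a0\<close> is a chain. The bound keeps the coefficient
      \<open>m - e\<close> nonnegative, and with \<open>e > 0\<close> it makes \<open>m\<close>
      positive.\<close>
    have e_m: "e \<le> m"
      using chain_bounded_singletonD[OF po less.prems(3), of a0] a0 AP by auto
    define g' where "g' = g - e *\<^sub>R indicator A"
    have g'_app: "g' a = g a - e * indicator A a" for a by (simp add: g'_def scaleR_fun_def)
    have smaller: "card {a \<in> P. g' a \<noteq> 0} < card ?S"
    proof (rule psubset_card_mono[OF finS])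
      have "{a \<in> P. g' a \<noteq> 0} \<subseteq> ?S" using AP by (auto simp: g'_app indicator_def)
      moreover have "a0 \<in> ?S" "a0 \<notin> {a \<in> P. g' a \<noteq> 0}" using a0 AP by (auto simp: g'_app)
      ultimately show "{a \<in> P. g' a \<noteq> 0} \<subset> ?S" by blast
    qed
    have g'_nonneg: "0 \<le> g' a" for a using nonneg[of a] e_le by (auto simp: g'_app indicator_def)
    have "sum g' C \<le> m - e" if C: "C \<subseteq> P" "C \<in> Chains r" for C
    proof -
      have finC: "finite C" using C(1) fin by (rule finite_subset)
      have sum_g': "sum g' C \<le> sum g C"
        by (rule sum_mono) (use e_pos in \<open>simp add: g'_app indicator_def\<close>)
      show ?thesis
      proof (cases "C \<inter> A = {}")
        case False
        then obtain a where a: "a \<in> C" "a \<in> A" by blast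
        have "sum g' (C - {a}) \<le> sum g (C - {a})"
          by (rule sum_mono) (use e_pos in \<open>simp add: g'_app indicator_def\<close>)
        then have "sum g' C \<le> sum g C - e"
          using sum.remove[OF finC a(1), of g'] sum.remove[OF finC a(1), of g] a(2) by (simp add: g'_app)
        then show ?thesis using chain_boundedD[OF less.prems(3) C] by linarith
      next
        case disj: True
        \<comment> \<open>Elements of weight 0 are discarded because only those of the support are
          known to lie above some element of \<open>A\<close>.\<close>
        define B where "B = C \<inter> ?S"
        have sumB: "sum g C = sum g B"
          unfolding B_def by (rule sum.mono_neutral_right[OF finC]) (use C in auto)
        show ?thesis
        proof (cases "B = {}")
          case True
          then show ?thesis using sumB sum_g' e_m by simp
        next
          case False
          have chB: "B \<in> Chains r" using Chains_subset[OF C(2)] by (simp add: B_def)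
          have finB: "finite B" using finC by (simp add: B_def)
          obtain c where c: "c \<in> B" "\<And>b. b \<in> B \<Longrightarrow> (c, b) \<in> r"
            using finite_chain_has_bottom[OF partial_order_onD(3)[OF po] finB False chB] by blast
          obtain a where a: "a \<in> A" "(a, c) \<in> r" using below c(1) by (auto simp: B_def)
          have aP: "a \<in> P" using a AP by blast
          have "insert a B \<in> Chains r"
            using Chains_insert_below[OF chB partial_order_onD(2)[OF po aP]]
              transD[OF partial_order_onD(3)[OF po] a(2) c(2)] by blast
          moreover have "insert a B \<subseteq> P" using aP C(1) by (auto simp: B_def)
          ultimately have "sum g (insert a B) \<le> m"
            using chain_boundedD[OF less.prems(3)] by blast
          moreover have "a \<notin> B" using disj a(1) by (auto simp: B_def)
          ultimately show ?thesis using finB sumB sum_g' e_le[OF a(1)] by simp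
        qed
      qed
    qed
    then have "chain_bounded P r (m - e) g'" by (simp add: chain_bounded_def)
    moreover have "\<forall>a. a \<notin> P \<longrightarrow> g' a = 0"
      using less.prems(2) AP by (auto simp: g'_app indicator_def)
    ultimately obtain v where v: "v \<in> convex hull (antichain_vertices P r)" "g' = (m - e) *\<^sub>R v"
      using less.hyps[OF smaller] g'_nonneg by blast
    \<comment> \<open>The two parts of \<open>g\<close>, of total weights \<open>m - e\<close> and
      \<open>e\<close>, are divided by \<open>m\<close> to become a convex combination.\<close>
    define w where "w = ((m - e) / m) *\<^sub>R v + (e / m) *\<^sub>R indicator A"
    have "indicator A \<in> convex hull (antichain_vertices P r)"
      using antiA by (intro hull_inc) (auto simp: antichain_vertices_def)
    then have "w \<in> convex hull (antichain_vertices P r)"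
      unfolding w_def using e_pos e_m v(1)
      by (intro convexD[OF convex_convex_hull]) (auto simp: diff_divide_distrib)
    moreover have "g = m *\<^sub>R w"
    proof -
      have "m *\<^sub>R w = (m - e) *\<^sub>R v + e *\<^sub>R indicator A"
        using e_pos e_m by (simp add: w_def scaleR_add_right)
      then show ?thesis using v(2) by (simp add: g'_def diff_eq_eq)
    qed
    ultimately show ?thesis by blast
  qed
qed

lemma chain_polytope_eq_convex_hull:
  assumes fin: "finite P" and po: "partial_order_on P r"
  shows "chain_polytope P r = convex hull (antichain_vertices P r)"
proof
  show "convex hull (antichain_vertices P r) \<subseteq> chain_polytope P r"
    using antichain_vertices_subset_chain_polytope[OF fin] convex_chain_polytope by (rule hull_minimal)
  show "chain_polytope P r \<subseteq> convex hull (antichain_vertices P r)"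
  proof
    fix g assume "g \<in> chain_polytope P r"
    then obtain v where "v \<in> convex hull (antichain_vertices P r)" "g = 1 *\<^sub>R v"
      using antichain_decomposition[OF fin po, of g 1] by (auto simp: mem_chain_polytope_iff)
    then show "g \<in> convex hull (antichain_vertices P r)" by simp
  qed
qed

section \<open>Differences of lattice polytopes\<close>

lemma minkowski_diff_convex_hull:
  fixes A B :: "'v::real_vector set"
  shows "minkowski_diff (convex hull A) (convex hull B) = convex hull (minkowski_diff A B)"
proof -
  have eq: "minkowski_diff X Y = X + (\<lambda>x. (-1) *\<^sub>R x) ` Y" for X Y :: "'v set"
    by (auto simp: minkowski_diff_def set_plus_def)
  show ?thesis unfolding eq convex_hull_set_plus convex_hull_scaling ..
qed

lemma lattice_polytope_minkowski_diff:
  assumes "lattice_polytope P S" "lattice_polytope P T"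
  shows "lattice_polytope P (minkowski_diff S T)"
proof -
  obtain V W where V: "finite V" "V \<subseteq> int_lattice P" "S = convex hull V"
    and W: "finite W" "W \<subseteq> int_lattice P" "T = convex hull W"
    using assms by (auto simp: lattice_polytope_def)
  have "minkowski_diff V W = (\<lambda>(x, y). x - y) ` (V \<times> W)" by (force simp: minkowski_diff_def)
  then have "finite (minkowski_diff V W)" using V(1) W(1) by simp
  moreover have "minkowski_diff V W \<subseteq> int_lattice P"
    using V(2) W(2) unfolding minkowski_diff_def int_lattice_def by (auto dest!: subsetD)
  ultimately show ?thesis
    unfolding lattice_polytope_def V(3) W(3) minkowski_diff_convex_hull by blast
qed

lemma lattice_polytope_chain_polytope:
  assumes "finite P" "partial_order_on P r"
  shows "lattice_polytope P (chain_polytope P r)"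
  unfolding lattice_polytope_def chain_polytope_eq_convex_hull[OF assms]
  using finite_antichain_vertices[OF assms(1)] antichain_vertices_int_lattice by blast

section \<open>Counting by signs\<close>

lemma chain_bounded_of_nat_iff:
  assumes "\<And>a. a \<in> Q \<Longrightarrow> f a = of_nat (g a)"
  shows "chain_bounded Q r (of_nat k :: 'b::linordered_semidom) f \<longleftrightarrow> chain_bounded Q r k g"
proof -
  have "sum f C = of_nat (sum g C)" if "C \<subseteq> Q" for C
    using assms that by (auto intro: sum.cong)
  then show ?thesis unfolding chain_bounded_def by (metis of_nat_le_iff)
qed

lemma chain_bounded_of_int_iff:
  assumes "\<And>a. a \<in> Q \<Longrightarrow> f a = of_int (g a)"
  shows "chain_bounded Q r (real k) f \<longleftrightarrow> chain_bounded Q r (int k) g"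
proof -
  have "sum f C = of_int (sum g C)" if "C \<subseteq> Q" for C
    using assms that by (auto intro: sum.cong)
  then show ?thesis unfolding chain_bounded_def by (metis of_int_le_iff of_int_of_nat_eq)
qed

lemma chain_bounded_mono:
  fixes f g :: "'a \<Rightarrow> 'b::ordered_comm_monoid_add"
  assumes "chain_bounded Q r m g" "\<And>a. a \<in> Q \<Longrightarrow> f a \<le> g a"
  shows "chain_bounded Q r m f"
  unfolding chain_bounded_def
proof (intro allI impI)
  fix C assume C: "C \<subseteq> Q" "C \<in> Chains r"
  have "sum f C \<le> sum g C" by (rule sum_mono) (use assms(2) C(1) in blast)
  also have "\<dots> \<le> m" using chain_boundedD[OF assms(1) C] .
  finally show "sum f C \<le> m" .
qed

lemma chain_bounded_scale:
  fixes g :: "'a \<Rightarrow> real"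
  assumes "chain_bounded Q r m g" "0 \<le> c"
  shows "chain_bounded Q r (c * m) (\<lambda>a. c * g a)"
  using assms by (auto simp: chain_bounded_def mult_left_mono simp flip: sum_distrib_left)

text \<open>Elements of weight 0 change no sum, and the part of a chain inside \<open>P1\<close> is
  again a chain. This replaces the positive or negative part of a point on \<open>P\<close> by the
  point on one sign class.\<close>

lemma chain_bounded_support:
  assumes "finite P" "P1 \<subseteq> P" "\<And>a. a \<in> P1 \<Longrightarrow> f a = g a" "\<And>a. a \<in> P - P1 \<Longrightarrow> f a = 0"
  shows "chain_bounded P r m f \<longleftrightarrow> chain_bounded P1 r m g"
proof -
  have sum: "sum f C = sum g (C \<inter> P1)" if "C \<subseteq> P" for C
    using assms that finite_subset[OF that assms(1)] by (intro sum.mono_neutral_cong_right) auto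
  show ?thesis
  proof
    assume f: "chain_bounded P r m f"
    show "chain_bounded P1 r m g"
      unfolding chain_bounded_def
    proof (intro allI impI)
      fix C assume C: "C \<subseteq> P1" "C \<in> Chains r"
      then have "C \<subseteq> P" "C \<inter> P1 = C" using assms(2) by auto
      then show "sum g C \<le> m" using chain_boundedD[OF f \<open>C \<subseteq> P\<close> C(2)] sum[of C] by simp
    qed
  next
    assume g: "chain_bounded P1 r m g"
    show "chain_bounded P r m f"
      unfolding chain_bounded_def
    proof (intro allI impI)
      fix C assume C: "C \<subseteq> P" "C \<in> Chains r"
      then have "C \<inter> P1 \<in> Chains r" using Chains_subset by blast
      then show "sum f C \<le> m" using chain_boundedD[OF g, of "C \<inter> P1"] sum[OF C(1)] by simp
    qed
  qed
qed

text \<open>Coordinates outside \<open>P\<close> are left free, so that the same set can be cut down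
  to functions vanishing there, for lattice points, or to extensional ones, for the measure.\<close>

definition signed_region :: "'a set \<Rightarrow> 'a rel \<Rightarrow> 'a rel \<Rightarrow> real \<Rightarrow> ('a \<Rightarrow> real) set" where
  "signed_region P rp rm m =
    {x. chain_bounded P rp m (\<lambda>a. max 0 (x a)) \<and> chain_bounded P rm m (\<lambda>a. max 0 (- x a))}"

text \<open>Chain polytopes are anti-blocking, so in \<open>x = g - h\<close> one may shrink \<open>g\<close> and \<open>h\<close>
  to the positive and the negative part of \<open>x\<close>.\<close>

lemma scaled_minkowski_diff_chain_polytopes:
  assumes rp: "partial_order_on P rp" and rm: "partial_order_on P rm" and m: "0 \<le> m"
  shows "(\<lambda>x. m *\<^sub>R x) ` minkowski_diff (chain_polytope P rp) (chain_polytope P rm) =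
    {x \<in> signed_region P rp rm m. \<forall>a. a \<notin> P \<longrightarrow> x a = 0}"
proof (intro set_eqI iffI)
  fix x assume "x \<in> (\<lambda>x. m *\<^sub>R x) ` minkowski_diff (chain_polytope P rp) (chain_polytope P rm)"
  then obtain g h where g: "g \<in> chain_polytope P rp" and h: "h \<in> chain_polytope P rm"
    and x: "x = m *\<^sub>R (g - h)"
    by (auto simp: minkowski_diff_def)
  have xa: "x a = m * g a - m * h a" for a by (simp add: x scaleR_fun_def algebra_simps)
  have nonneg: "0 \<le> m * g a" "0 \<le> m * h a" if "a \<in> P" for a
    using g h m that by (auto simp: chain_polytope_def)
  have "chain_bounded P rp (m * 1) (\<lambda>a. m * g a)" "chain_bounded P rm (m * 1) (\<lambda>a. m * h a)"
    using g h m by (auto intro!: chain_bounded_scale simp del: mult_1_right simp: mem_chain_polytope_iff)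
  then have "chain_bounded P rp m (\<lambda>a. max 0 (x a))" "chain_bounded P rm m (\<lambda>a. max 0 (- x a))"
    using nonneg by (auto elim!: chain_bounded_mono simp: xa)
  moreover have "x a = 0" if "a \<notin> P" for a
    using g h that by (simp add: xa chain_polytope_def)
  ultimately show "x \<in> {x \<in> signed_region P rp rm m. \<forall>a. a \<notin> P \<longrightarrow> x a = 0}"
    by (simp add: signed_region_def)
next
  fix x assume "x \<in> {x \<in> signed_region P rp rm m. \<forall>a. a \<notin> P \<longrightarrow> x a = 0}"
  then have xp: "chain_bounded P rp m (\<lambda>a. max 0 (x a))" and xm: "chain_bounded P rm m (\<lambda>a. max 0 (- x a))"
    and x0: "\<And>a. a \<notin> P \<Longrightarrow> x a = 0" by (auto simp: signed_region_def)
  define g where "g a = max 0 (x a) / m" for a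
  define h where "h a = max 0 (- x a) / m" for a
  have "chain_bounded P rp (1 / m * m) g" "chain_bounded P rm (1 / m * m) h"
    using chain_bounded_scale[OF xp, of "1 / m"] chain_bounded_scale[OF xm, of "1 / m"] m
    by (simp_all add: g_def[abs_def] h_def[abs_def])
  \<comment> \<open>An inequality rather than an equation, so that \<open>m = 0\<close> is included,
    where division by zero yields 0. This case occurs for \<open>n = 1\<close>.\<close>
  moreover have "1 / m * m \<le> 1" by simp
  ultimately have "chain_bounded P rp 1 g" "chain_bounded P rm 1 h"
    unfolding chain_bounded_def by (meson order_trans)+
  then have "g \<in> chain_polytope P rp" "h \<in> chain_polytope P rm"
    using m x0 by (auto simp: chain_polytope_def chain_bounded_def g_def h_def)
  moreover have "x = m *\<^sub>R (g - h)"
  proof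
    fix a
    show "x a = (m *\<^sub>R (g - h)) a"
    proof (cases "m = 0 \<and> a \<in> P")
      case True
      \<comment> \<open>Singleton chains bound both the positive and the negative part of
        \<open>x a\<close> by \<open>m = 0\<close>.\<close>
      then have "x a = 0"
        using chain_bounded_singletonD[OF rp xp] chain_bounded_singletonD[OF rm xm] by force
      then show ?thesis using True by (simp add: scaleR_fun_def)
    next
      case False
      then show ?thesis
        using x0 by (cases "m = 0") (auto simp: scaleR_fun_def g_def h_def max_def simp flip: diff_divide_distrib)
    qed
  qed
  ultimately show "x \<in> (\<lambda>x. m *\<^sub>R x) ` minkowski_diff (chain_polytope P rp) (chain_polytope P rm)"
    by (auto simp: minkowski_diff_def)
qed

text \<open>The parameters \<open>s\<close> and \<open>t\<close> shift the two sign classes of \<open>z\<close>: \<open>(1, 0)\<close> encodes the lattice point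
  \<open>z + 1\<close>, while \<open>(0, 0)\<close> and \<open>(1, 1)\<close> encode the corners of the unit cube \<open>z + [0,1)\<close>
  that are nearest to and farthest from the origin.\<close>

definition shifted_points :: "'a set \<Rightarrow> 'a rel \<Rightarrow> 'a rel \<Rightarrow> nat \<Rightarrow> nat \<Rightarrow> nat \<Rightarrow> ('a \<Rightarrow> int) set" where
  "shifted_points P rp rm s t k = {z \<in> P \<rightarrow>\<^sub>E UNIV.
     chain_bounded {a \<in> P. 0 \<le> z a} rp (int k) (\<lambda>a. z a + int s) \<and>
     chain_bounded {a \<in> P. z a < 0} rm (int k) (\<lambda>a. int t - 1 - z a)}"

lemma finite_ordered_bipartitions: "finite P \<Longrightarrow> finite (ordered_bipartitions P)"
  by (rule finite_subset[of _ "Pow P \<times> Pow P"]) (auto simp: ordered_bipartitions_def)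

text \<open>The lower bounds on the weights are what ties the partition to the signs:
  \<open>g a\<close> at least \<open>s\<close> means that \<open>z a\<close> is nonnegative, and
  \<open>h a\<close> at least \<open>t\<close> that it is negative. So \<open>P1\<close> and
  \<open>P2\<close> can be read off from \<open>z\<close>.\<close>

lemma shifted_points_bij:
  "bij_betw (\<lambda>((P1, P2), g, h). \<lambda>a\<in>P. if a \<in> P1 then int (g a) - int s else int t - 1 - int (h a))
    (Sigma (ordered_bipartitions P) (\<lambda>(P1, P2).
       chain_bounded_maps P1 (Restr rp P1) s k \<times> chain_bounded_maps P2 (Restr rm P2) t k))
    (shifted_points P rp rm s t k)"
  (is "bij_betw ?F ?S ?Z")
proof -
  let ?P1 = "\<lambda>z. {a \<in> P. 0 \<le> z a}" and ?P2 = "\<lambda>z. {a \<in> P. z a < (0::int)}"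
  let ?G = "\<lambda>z. ((?P1 z, ?P2 z), \<lambda>a\<in>?P1 z. nat (z a + int s), \<lambda>a\<in>?P2 z. nat (int t - 1 - z a))"
  have F: "?P1 z = P1 \<and> ?P2 z = P2 \<and> (\<forall>a\<in>P1. z a + int s = int (g a)) \<and>
      (\<forall>a\<in>P2. int t - 1 - z a = int (h a)) \<and> g \<in> extensional P1 \<and> h \<in> extensional P2 \<and>
      chain_bounded P1 rp k g \<and> chain_bounded P2 rm k h"
    if "((P1, P2), g, h) \<in> ?S" and z: "z = ?F ((P1, P2), g, h)" for P1 P2 g h z
  proof -
    have 1: "P1 \<union> P2 = P" "P1 \<inter> P2 = {}" "\<And>a. a \<in> P1 \<Longrightarrow> s \<le> g a" "\<And>a. a \<in> P2 \<Longrightarrow> t \<le> h a"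
      "g \<in> extensional P1" "h \<in> extensional P2" "chain_bounded P1 rp k g" "chain_bounded P2 rm k h"
      using that(1) by (auto simp: ordered_bipartitions_def chain_bounded_maps_def PiE_iff chain_bounded_Restr)
    have z1: "z a = int (g a) - int s" if "a \<in> P1" for a using that 1(1) by (auto simp: z)
    have z2: "z a = int t - 1 - int (h a)" if "a \<in> P2" for a using that 1(1,2) by (auto simp: z)
    have "0 \<le> z a" if "a \<in> P1" for a using z1[OF that] 1(3)[OF that] by simp
    moreover have "z a < 0" if "a \<in> P2" for a using z2[OF that] 1(4)[OF that] by simp
    ultimately have "?P1 z = P1" "?P2 z = P2" using 1(1,2) by (auto simp: not_less[symmetric])
    then show ?thesis using 1 z1 z2 by simp
  qed
  show ?thesis
  proof (rule bij_betw_byWitness[where f'="?G"])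
    show "\<forall>y\<in>?S. ?G (?F y) = y"
    proof
      fix y assume y: "y \<in> ?S"
      obtain P1 P2 g h where yy: "y = ((P1, P2), g, h)" by (metis surj_pair)
      define z where "z = ?F y"
      have Fz: "?P1 z = P1" "?P2 z = P2" "\<forall>a\<in>P1. z a + int s = int (g a)"
        "\<forall>a\<in>P2. int t - 1 - z a = int (h a)" "g \<in> extensional P1" "h \<in> extensional P2"
        using F[of P1 P2 g h z] y unfolding yy z_def by blast+
      have "(\<lambda>a\<in>P1. nat (z a + int s)) = g" "(\<lambda>a\<in>P2. nat (int t - 1 - z a)) = h"
        using Fz(3-6) by (auto simp: fun_eq_iff extensional_def)
      then have "?G z = y" unfolding Fz(1,2) yy by simp
      then show "?G (?F y) = y" unfolding z_def .
    qed
    show "\<forall>z\<in>?Z. ?F (?G z) = z"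
    proof
      fix z assume "z \<in> ?Z"
      then have ext: "z \<in> extensional P" by (auto simp: shifted_points_def PiE_iff)
      show "?F (?G z) = z"
        using ext by (auto simp: fun_eq_iff extensional_def)
    qed
    show "?F ` ?S \<subseteq> ?Z"
    proof
      fix z assume "z \<in> ?F ` ?S"
      then obtain P1 P2 g h where y: "((P1, P2), g, h) \<in> ?S" and z: "z = ?F ((P1, P2), g, h)" by auto
      have Fz: "?P1 z = P1" "?P2 z = P2" "\<And>a. a \<in> P1 \<Longrightarrow> z a + int s = int (g a)"
        "\<And>a. a \<in> P2 \<Longrightarrow> int t - 1 - z a = int (h a)" "chain_bounded P1 rp k g" "chain_bounded P2 rm k h"
        using F[OF y z] by blast+
      have "chain_bounded P1 rp (int k) (\<lambda>a. z a + int s)" "chain_bounded P2 rm (int k) (\<lambda>a. int t - 1 - z a)"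
        using chain_bounded_of_nat_iff[of P1 "\<lambda>a. z a + int s" g] chain_bounded_of_nat_iff[of P2 "\<lambda>a. int t - 1 - z a" h]
          Fz by simp_all
      moreover have "z \<in> P \<rightarrow>\<^sub>E UNIV" using z by simp
      ultimately show "z \<in> ?Z" unfolding shifted_points_def by (simp add: Fz(1,2))
    qed
    show "?G ` ?Z \<subseteq> ?S"
    proof
      fix y assume "y \<in> ?G ` ?Z"
      then obtain z where z: "z \<in> ?Z" and y: "y = ?G z" by blast
      have b: "chain_bounded (?P1 z) rp (int k) (\<lambda>a. z a + int s)" "chain_bounded (?P2 z) rm (int k) (\<lambda>a. int t - 1 - z a)"
        using z by (auto simp: shifted_points_def)
      have "chain_bounded (?P1 z) rp k (\<lambda>a\<in>?P1 z. nat (z a + int s))"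
        by (rule chain_bounded_of_nat_iff[THEN iffD1, OF _ b(1)]) auto
      moreover have "chain_bounded (?P2 z) rm k (\<lambda>a\<in>?P2 z. nat (int t - 1 - z a))"
        by (rule chain_bounded_of_nat_iff[THEN iffD1, OF _ b(2)]) auto
      ultimately have "(\<lambda>a\<in>?P1 z. nat (z a + int s)) \<in> chain_bounded_maps (?P1 z) (Restr rp (?P1 z)) s k"
        "(\<lambda>a\<in>?P2 z. nat (int t - 1 - z a)) \<in> chain_bounded_maps (?P2 z) (Restr rm (?P2 z)) t k"
        unfolding chain_bounded_maps_def chain_bounded_Restr by auto
      moreover have "(?P1 z, ?P2 z) \<in> ordered_bipartitions P" by (auto simp: ordered_bipartitions_def)
      ultimately show "y \<in> ?S" unfolding y by simp
    qed
  qed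
qed

lemma
  assumes fin: "finite P" and rp: "partial_order_on P rp" and rm: "partial_order_on P rm"
  shows finite_shifted_points: "finite (shifted_points P rp rm s t k)"
    and card_shifted_points: "card (shifted_points P rp rm s t k) =
      (\<Sum>(P1, P2) \<in> ordered_bipartitions P.
        card (chain_bounded_maps P1 (Restr rp P1) s k) * card (chain_bounded_maps P2 (Restr rm P2) t k))"
proof -
  let ?T = "\<lambda>(P1, P2). chain_bounded_maps P1 (Restr rp P1) s k \<times> chain_bounded_maps P2 (Restr rm P2) t k"
  have finT: "finite (?T p)" if "p \<in> ordered_bipartitions P" for p
  proof -
    obtain P1 P2 where p: "p = (P1, P2)" by fastforce
    then have sub: "P1 \<subseteq> P" "P2 \<subseteq> P" using that by (auto simp: ordered_bipartitions_def)
    show ?thesis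
      unfolding p using sub fin
      by (auto intro!: finite_cartesian_product finite_chain_bounded_maps partial_order_on_Restr[OF rp]
          partial_order_on_Restr[OF rm] intro: finite_subset)
  qed
  show "finite (shifted_points P rp rm s t k)"
    using bij_betw_finite[OF shifted_points_bij, of P rp s k rm t] finite_ordered_bipartitions[OF fin] finT
    by (simp add: finite_SigmaI)
  have "card (shifted_points P rp rm s t k) = card (Sigma (ordered_bipartitions P) ?T)"
    using bij_betw_same_card[OF shifted_points_bij] by (rule sym)
  also have "\<dots> = (\<Sum>p\<in>ordered_bipartitions P. card (?T p))"
    using finT by (intro card_SigmaI finite_ordered_bipartitions[OF fin]) auto
  also have "\<dots> = (\<Sum>(P1, P2) \<in> ordered_bipartitions P.
        card (chain_bounded_maps P1 (Restr rp P1) s k) * card (chain_bounded_maps P2 (Restr rm P2) t k))"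
    by (rule sum.cong) (auto simp: card_cartesian_product)
  finally show "card (shifted_points P rp rm s t k) = \<dots>" .
qed

text \<open>The signs of \<open>x\<close> need to agree with those of \<open>z\<close> only weakly,
  since a coordinate 0 adds nothing on either side. Hence it applies to lattice points with zeros as
  well as to every point of a cube.\<close>

lemma signed_region_shift_iff:
  assumes fin: "finite P"
    and "\<And>a. a \<in> P \<Longrightarrow> 0 \<le> z a \<Longrightarrow> 0 \<le> x a" "\<And>a. a \<in> P \<Longrightarrow> z a < 0 \<Longrightarrow> x a \<le> 0"
  shows "x \<in> signed_region P rp rm m \<longleftrightarrow>
    chain_bounded {a \<in> P. 0 \<le> (z a::int)} rp m x \<and> chain_bounded {a \<in> P. z a < 0} rm m (\<lambda>a. - x a)"
proof -
  have "chain_bounded P rp m (\<lambda>a. max 0 (x a)) \<longleftrightarrow> chain_bounded {a \<in> P. 0 \<le> z a} rp m x"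
    by (rule chain_bounded_support[OF fin]) (use assms in \<open>auto simp: max_def not_le order.antisym\<close>)
  moreover have "chain_bounded P rm m (\<lambda>a. max 0 (- x a)) \<longleftrightarrow> chain_bounded {a \<in> P. z a < 0} rm m (\<lambda>a. - x a)"
    by (rule chain_bounded_support[OF fin]) (use assms in \<open>auto simp: max_def not_le not_less order.antisym\<close>)
  ultimately show ?thesis by (simp add: signed_region_def)
qed

lemma card_lattice_points:
  assumes fin: "finite P"
  shows "card ({x \<in> signed_region P rp rm (real k). \<forall>a. a \<notin> P \<longrightarrow> x a = 0} \<inter> int_lattice P)
    = card (shifted_points P rp rm 1 0 k)"
proof -
  \<comment> \<open>With the shift by 1, a zero coordinate of the lattice point has index -1 and
    falls into the negative class, while the positive class has weights at least 1.\<close>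
  let ?F = "\<lambda>z a. if a \<in> P then real_of_int (z a + 1) else 0"
  let ?G = "\<lambda>x. \<lambda>a\<in>P. \<lfloor>x a\<rfloor> - 1"
  let ?X = "{x \<in> signed_region P rp rm (real k). \<forall>a. a \<notin> P \<longrightarrow> x a = 0} \<inter> int_lattice P"
  have iff: "?F z \<in> signed_region P rp rm (real k) \<longleftrightarrow> z \<in> shifted_points P rp rm 1 0 k"
    if "z \<in> P \<rightarrow>\<^sub>E UNIV" for z
  proof -
    have "?F z \<in> signed_region P rp rm (real k) \<longleftrightarrow>
        chain_bounded {a \<in> P. 0 \<le> z a} rp (real k) (?F z) \<and>
        chain_bounded {a \<in> P. z a < 0} rm (real k) (\<lambda>a. - ?F z a)"
      by (rule signed_region_shift_iff[OF fin]) auto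
    also have "chain_bounded {a \<in> P. 0 \<le> z a} rp (real k) (?F z) \<longleftrightarrow>
        chain_bounded {a \<in> P. 0 \<le> z a} rp (int k) (\<lambda>a. z a + int 1)"
      by (rule chain_bounded_of_int_iff) auto
    also have "chain_bounded {a \<in> P. z a < 0} rm (real k) (\<lambda>a. - ?F z a) \<longleftrightarrow>
        chain_bounded {a \<in> P. z a < 0} rm (int k) (\<lambda>a. int 0 - 1 - z a)"
      by (rule chain_bounded_of_int_iff) auto
    finally show ?thesis using that by (simp add: shifted_points_def)
  qed
  have FG: "?F (?G x) = x" if "x \<in> int_lattice P" for x
  proof
    fix a show "?F (?G x) a = x a"
      using that by (cases "a \<in> P") (auto simp: int_lattice_def elim!: Ints_cases)
  qed
  have "bij_betw ?F (shifted_points P rp rm 1 0 k) ?X"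
  proof (rule bij_betw_byWitness[where f'="?G"])
    show "\<forall>z\<in>shifted_points P rp rm 1 0 k. ?G (?F z) = z"
      by (auto simp: shifted_points_def PiE_iff extensional_def fun_eq_iff)
    show "\<forall>x\<in>?X. ?F (?G x) = x" using FG by blast
    show "?F ` shifted_points P rp rm 1 0 k \<subseteq> ?X"
    proof
      fix x assume "x \<in> ?F ` shifted_points P rp rm 1 0 k"
      then obtain z where z: "z \<in> shifted_points P rp rm 1 0 k" and x: "x = ?F z" by blast
      then have "x \<in> signed_region P rp rm (real k)" using iff[of z] by (simp add: shifted_points_def)
      moreover have "x \<in> int_lattice P" unfolding x int_lattice_def by auto
      ultimately show "x \<in> ?X" by (simp add: x)
    qed
    show "?G ` ?X \<subseteq> shifted_points P rp rm 1 0 k"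
    proof
      fix z assume "z \<in> ?G ` ?X"
      then obtain x where x: "x \<in> ?X" and z: "z = ?G x" by blast
      then have "?F z = x" using FG[of x] by blast
      moreover have "z \<in> P \<rightarrow>\<^sub>E UNIV" unfolding z by simp
      ultimately show "z \<in> shifted_points P rp rm 1 0 k" using iff[of z] x by auto
    qed
  qed
  then show ?thesis by (rule bij_betw_same_card[symmetric])
qed

section \<open>Volume\<close>

text \<open>Half-open intervals make the cubes disjoint: the index of the cube containing
  \<open>x\<close> is the floor of \<open>k * x\<close>, and no boundaries have to be discarded. No
  cube crosses a coordinate hyperplane, so signs are weakly constant on each.\<close>

definition grid_cube :: "'a set \<Rightarrow> nat \<Rightarrow> ('a \<Rightarrow> int) \<Rightarrow> ('a \<Rightarrow> real) set" where
  "grid_cube P k z = (\<Pi>\<^sub>E a\<in>P. {real_of_int (z a) / real k ..< (real_of_int (z a) + 1) / real k})"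

interpretation lborel_product: product_sigma_finite "\<lambda>_. lborel :: real measure"
  by standard

lemma sets_grid_cube: "finite P \<Longrightarrow> grid_cube P k z \<in> sets (Pi\<^sub>M P (\<lambda>_. lborel))"
  unfolding grid_cube_def by (rule sets_PiM_I_finite) simp_all

lemma emeasure_grid_cube:
  assumes "finite P"
  shows "emeasure (Pi\<^sub>M P (\<lambda>_. lborel)) (grid_cube P k z) = ennreal (1 / real k ^ card P)"
proof -
  have "emeasure lborel {real_of_int (z a) / real k ..< (real_of_int (z a) + 1) / real k} = ennreal (1 / real k)" for a
    by (simp add: divide_right_mono flip: diff_divide_distrib)
  then show ?thesis
    unfolding grid_cube_def using assms
    by (subst lborel_product.emeasure_PiM) (simp_all add: prod_ennreal ennreal_power power_divide)
qed

lemma mem_grid_cube_iff: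
  assumes "k \<ge> 1" "z \<in> P \<rightarrow>\<^sub>E UNIV"
  shows "x \<in> grid_cube P k z \<longleftrightarrow> x \<in> extensional P \<and> z = (\<lambda>a\<in>P. \<lfloor>real k * x a\<rfloor>)"
proof -
  have "real_of_int i / real k \<le> y \<and> y < (real_of_int i + 1) / real k \<longleftrightarrow> i = \<lfloor>real k * y\<rfloor>" for i y
    using assms(1) by (simp add: eq_commute[of i] floor_eq_iff field_simps)
  then have "x \<in> grid_cube P k z \<longleftrightarrow> x \<in> extensional P \<and> (\<forall>a\<in>P. z a = \<lfloor>real k * x a\<rfloor>)"
    by (auto simp: grid_cube_def PiE_iff)
  also have "(\<forall>a\<in>P. z a = \<lfloor>real k * x a\<rfloor>) \<longleftrightarrow> z = (\<lambda>a\<in>P. \<lfloor>real k * x a\<rfloor>)"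
    using assms(2) by (auto simp: fun_eq_iff PiE_iff extensional_def)
  finally show ?thesis .
qed

lemma
  assumes fin: "finite P" and k: "k \<ge> 1" and Z: "finite Z" "Z \<subseteq> P \<rightarrow>\<^sub>E UNIV"
  shows fmeasurable_grid_cubes: "(\<Union>z\<in>Z. grid_cube P k z) \<in> fmeasurable (Pi\<^sub>M P (\<lambda>_. lborel))"
    and measure_grid_cubes:
      "measure (Pi\<^sub>M P (\<lambda>_. lborel)) (\<Union>z\<in>Z. grid_cube P k z) = real (card Z) / real k ^ card P"
proof -
  let ?M = "Pi\<^sub>M P (\<lambda>_. lborel :: real measure)"
  have cube: "grid_cube P k z \<in> fmeasurable ?M" for z
    by (rule fmeasurableI) (simp_all add: sets_grid_cube emeasure_grid_cube fin)
  show "(\<Union>z\<in>Z. grid_cube P k z) \<in> fmeasurable ?M"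
    using Z(1) cube by (intro fmeasurable.finite_UN) auto
  have "disjoint_family_on (grid_cube P k) Z"
    unfolding disjoint_family_on_def
  proof (intro ballI impI)
    fix z z' assume z: "z \<in> Z" "z' \<in> Z" "z \<noteq> z'"
    have "z \<in> P \<rightarrow>\<^sub>E UNIV" "z' \<in> P \<rightarrow>\<^sub>E UNIV" using z Z(2) by auto
    then have "z = z'" if "x \<in> grid_cube P k z" "x \<in> grid_cube P k z'" for x
      using that by (simp add: mem_grid_cube_iff[OF k])
    then show "grid_cube P k z \<inter> grid_cube P k z' = {}" using z(3) by auto
  qed
  then have "measure ?M (\<Union>z\<in>Z. grid_cube P k z) = (\<Sum>z\<in>Z. measure ?M (grid_cube P k z))"
    using Z(1) by (intro measure_finite_Union) (auto simp: sets_grid_cube emeasure_grid_cube fin)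
  also have "\<dots> = real (card Z) / real k ^ card P"
    by (simp add: measure_def emeasure_grid_cube fin)
  finally show "measure ?M (\<Union>z\<in>Z. grid_cube P k z) = real (card Z) / real k ^ card P" .
qed

text \<open>The finite set \<open>P\<close> has finitely many chains, and each imposes one
  inequality between measurable functions of the coordinates.\<close>

lemma sets_signed_region:
  assumes fin: "finite P"
  shows "signed_region P rp rm m \<inter> extensional P \<in> sets (Pi\<^sub>M P (\<lambda>_. lborel))"
proof -
  let ?M = "Pi\<^sub>M P (\<lambda>_. lborel :: real measure)"
  have comp: "(\<lambda>x. x a) \<in> borel_measurable ?M" if "a \<in> P" for a
    using measurable_component_singleton[OF that, of "\<lambda>_. lborel"] by simp
  have meas: "{x \<in> space ?M. chain_bounded P r m (\<lambda>a. f (x a))} \<in> sets ?M"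
    if f: "f \<in> borel_measurable borel" for f :: "real \<Rightarrow> real" and r
  proof -
    let ?C = "{C. C \<subseteq> P \<and> C \<in> Chains r}"
    have "finite ?C" using fin by simp
    moreover have "{x \<in> space ?M. (\<Sum>a\<in>C. f (x a)) \<le> m} \<in> sets ?M" if "C \<in> ?C" for C
    proof -
      have "(\<lambda>x. \<Sum>a\<in>C. f (x a)) \<in> borel_measurable ?M"
        using that by (intro borel_measurable_sum measurable_compose[OF comp f]) auto
      then show ?thesis by (intro borel_measurable_le) simp_all
    qed
    ultimately have "{x \<in> space ?M. \<forall>C\<in>?C. (\<Sum>a\<in>C. f (x a)) \<le> m} \<in> sets ?M"
      by (rule sets.sets_Collect_finite_All[rotated])
    then show ?thesis by (simp add: chain_bounded_def imp_conjL)
  qed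
  have "signed_region P rp rm m \<inter> extensional P =
    {x \<in> space ?M. chain_bounded P rp m (\<lambda>a. max 0 (x a))} \<inter>
    {x \<in> space ?M. chain_bounded P rm m (\<lambda>a. max 0 (- x a))}"
    by (auto simp: signed_region_def space_PiM PiE_def)
  also have "\<dots> \<in> sets ?M"
    using meas[of "\<lambda>x. max 0 x" rp] meas[of "\<lambda>x. max 0 (- x)" rm] by (intro sets.Int) simp_all
  finally show ?thesis .
qed

section \<open>Inner and outer approximation by cubes\<close>

lemma chain_bounded_divide:
  fixes g :: "'a \<Rightarrow> real"
  assumes "chain_bounded Q r (real k) g" "k \<ge> 1"
  shows "chain_bounded Q r 1 (\<lambda>a. g a / real k)"
  using chain_bounded_scale[OF assms(1), of "1 / real k"] assms(2) by simp

lemma chain_bounded_multiply: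
  fixes g :: "'a \<Rightarrow> real"
  assumes "chain_bounded Q r 1 g"
  shows "chain_bounded Q r (real k) (\<lambda>a. real k * g a)"
  using chain_bounded_scale[OF assms, of "real k"] by simp

text \<open>The corner farthest from the origin dominates the absolute values of all coordinates in
  the cube, so its chain sums bound those of every point.\<close>

lemma grid_cubes_subset_signed_region:
  assumes fin: "finite P" and k: "k \<ge> 1"
  shows "(\<Union>z\<in>shifted_points P rp rm 1 1 k. grid_cube P k z) \<subseteq> signed_region P rp rm 1 \<inter> extensional P"
proof
  fix x assume "x \<in> (\<Union>z\<in>shifted_points P rp rm 1 1 k. grid_cube P k z)"
  then obtain z where z: "z \<in> shifted_points P rp rm 1 1 k" and x: "x \<in> grid_cube P k z" by blast
  have x_ge: "real_of_int (z a) / real k \<le> x a" and x_le: "x a \<le> real_of_int (z a + 1) / real k"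
    if "a \<in> P" for a
    using x that by (auto simp: grid_cube_def PiE_iff less_imp_le)
  have pos: "0 \<le> x a" if "a \<in> P" "0 \<le> z a" for a
    using x_ge[OF that(1)] that(2) by (auto intro: order_trans[rotated])
  have neg: "x a \<le> 0" if "a \<in> P" "z a < 0" for a
  proof -
    have "real_of_int (z a + 1) / real k \<le> 0"
      using that(2) by (intro divide_nonpos_nonneg) auto
    then show ?thesis using x_le[OF that(1)] by linarith
  qed
  have "chain_bounded {a \<in> P. 0 \<le> z a} rp (real k) (\<lambda>a. real_of_int (z a + 1))"
    using z chain_bounded_of_int_iff[of "{a \<in> P. 0 \<le> z a}" _ "\<lambda>a. z a + 1"] by (simp add: shifted_points_def)
  then have "chain_bounded {a \<in> P. 0 \<le> z a} rp 1 (\<lambda>a. real_of_int (z a + 1) / real k)"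
    using k by (rule chain_bounded_divide)
  then have p: "chain_bounded {a \<in> P. 0 \<le> z a} rp 1 x"
    by (rule chain_bounded_mono) (use x_le in auto)
  have "chain_bounded {a \<in> P. z a < 0} rm (real k) (\<lambda>a. real_of_int (- z a))"
    using z chain_bounded_of_int_iff[of "{a \<in> P. z a < 0}" _ "\<lambda>a. - z a"] by (simp add: shifted_points_def)
  then have "chain_bounded {a \<in> P. z a < 0} rm 1 (\<lambda>a. real_of_int (- z a) / real k)"
    using k by (rule chain_bounded_divide)
  then have q: "chain_bounded {a \<in> P. z a < 0} rm 1 (\<lambda>a. - x a)"
    by (rule chain_bounded_mono) (use x_ge in auto)
  have "x \<in> signed_region P rp rm 1"
    using signed_region_shift_iff[OF fin, of z x] pos neg p q by blast
  then show "x \<in> signed_region P rp rm 1 \<inter> extensional P"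
    using x by (auto simp: grid_cube_def PiE_iff)
qed

text \<open>Moving a point to the corner of its cube nearest to the origin can only lower the chain
  sums of its positive and negative parts.\<close>

lemma signed_region_subset_grid_cubes:
  assumes fin: "finite P" and k: "k \<ge> 1"
  shows "signed_region P rp rm 1 \<inter> extensional P \<subseteq> (\<Union>z\<in>shifted_points P rp rm 0 0 k. grid_cube P k z)"
proof
  fix x assume x: "x \<in> signed_region P rp rm 1 \<inter> extensional P"
  define z where "z = (\<lambda>a\<in>P. \<lfloor>real k * x a\<rfloor>)"
  have za: "z a = \<lfloor>real k * x a\<rfloor>" if "a \<in> P" for a using that by (simp add: z_def)
  have zP: "z \<in> P \<rightarrow>\<^sub>E UNIV" by (simp add: z_def)
  have pos: "0 \<le> x a" if "a \<in> P" "0 \<le> z a" for a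
    using that k by (simp add: za zero_le_mult_iff)
  have neg: "x a \<le> 0" if "a \<in> P" "z a < 0" for a
    using that k by (simp add: za mult_less_0_iff)
  have p: "chain_bounded {a \<in> P. 0 \<le> z a} rp 1 x" and q: "chain_bounded {a \<in> P. z a < 0} rm 1 (\<lambda>a. - x a)"
    using signed_region_shift_iff[OF fin, of z x rp rm 1] pos neg x by blast+
  have "chain_bounded {a \<in> P. 0 \<le> z a} rp (real k) (\<lambda>a. real_of_int (z a + int 0))"
    by (rule chain_bounded_mono[OF chain_bounded_multiply[OF p]]) (simp add: za)
  then have "chain_bounded {a \<in> P. 0 \<le> z a} rp (int k) (\<lambda>a. z a + int 0)"
    by (subst (asm) chain_bounded_of_int_iff) (rule refl)
  moreover have "chain_bounded {a \<in> P. z a < 0} rm (real k) (\<lambda>a. real_of_int (int 0 - 1 - z a))"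
  proof (rule chain_bounded_mono[OF chain_bounded_multiply[OF q]])
    fix a assume "a \<in> {a \<in> P. z a < 0}"
    \<comment> \<open>For a negative index the nearest corner is the upper end
      \<open>z a + 1\<close>, which exceeds \<open>k * x a\<close> by the property of the
      floor.\<close>
    then show "real_of_int (int 0 - 1 - z a) \<le> real k * - x a"
      by (simp add: za) linarith
  qed
  then have "chain_bounded {a \<in> P. z a < 0} rm (int k) (\<lambda>a. int 0 - 1 - z a)"
    by (subst (asm) chain_bounded_of_int_iff) (rule refl)
  ultimately have "z \<in> shifted_points P rp rm 0 0 k" using zP by (simp add: shifted_points_def)
  moreover have "x \<in> grid_cube P k z"
    using mem_grid_cube_iff[OF k zP] x by (simp add: z_def)
  ultimately show "x \<in> (\<Union>z\<in>shifted_points P rp rm 0 0 k. grid_cube P k z)" by blast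
qed

lemma measure_signed_region_bounds:
  assumes fin: "finite P" and rp: "partial_order_on P rp" and rm: "partial_order_on P rm" and k: "k \<ge> 1"
  defines "V \<equiv> measure (Pi\<^sub>M P (\<lambda>_. lborel)) (signed_region P rp rm 1 \<inter> extensional P)"
  shows "real (card (shifted_points P rp rm 1 1 k)) / real k ^ card P \<le> V"
    and "V \<le> real (card (shifted_points P rp rm 0 0 k)) / real k ^ card P"
proof -
  let ?M = "Pi\<^sub>M P (\<lambda>_. lborel :: real measure)"
  note grid = fmeasurable_grid_cubes[OF fin k finite_shifted_points[OF fin rp rm]]
    measure_grid_cubes[OF fin k finite_shifted_points[OF fin rp rm]]
  have sub: "shifted_points P rp rm s t k \<subseteq> P \<rightarrow>\<^sub>E UNIV" for s t by (auto simp: shifted_points_def)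
  show upper: "V \<le> real (card (shifted_points P rp rm 0 0 k)) / real k ^ card P"
    unfolding V_def grid(2)[OF sub, symmetric]
    by (rule measure_mono_fmeasurable[OF signed_region_subset_grid_cubes[OF fin k] sets_signed_region[OF fin] grid(1)[OF sub]])
  \<comment> \<open>Monotonicity of \<open>measure\<close> requires the larger set to have finite
    measure; the outer cubes provide this.\<close>
  have "signed_region P rp rm 1 \<inter> extensional P \<in> fmeasurable ?M"
    by (rule fmeasurableI2[OF grid(1)[OF sub] signed_region_subset_grid_cubes[OF fin k] sets_signed_region[OF fin]])
  then show "real (card (shifted_points P rp rm 1 1 k)) / real k ^ card P \<le> V"
    unfolding V_def grid(2)[OF sub, symmetric]
    by (rule measure_mono_fmeasurable[OF grid_cubes_subset_signed_region[OF fin k] fmeasurableD[OF grid(1)[OF sub]]])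
qed

section \<open>Passage to the limit\<close>

lemma ordered_bipartitionsD:
  assumes "(P1, P2) \<in> ordered_bipartitions P" "finite P"
  shows "P1 \<subseteq> P" "P2 \<subseteq> P" "finite P1" "finite P2" "card P = card P1 + card P2"
proof -
  show "P1 \<subseteq> P" "P2 \<subseteq> P" using assms(1) by (auto simp: ordered_bipartitions_def)
  then show "finite P1" "finite P2" using assms(2) by (auto intro: finite_subset)
  then show "card P = card P1 + card P2"
    using assms(1) card_Un_disjoint[of P1 P2] by (auto simp: ordered_bipartitions_def)
qed

text \<open>Since \<open>card P\<close> is the sum of the two block sizes, the normalising power
  splits and each factor converges by itself. The limit is independent of \<open>s\<close> and
  \<open>t\<close>, so inner and outer cubes have the same limiting volume.\<close>

lemma card_shifted_points_tendsto:
  assumes fin: "finite P" and rp: "partial_order_on P rp" and rm: "partial_order_on P rm"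
    and st: "s \<in> {0, 1}" "t \<in> {0, 1}"
  shows "(\<lambda>k. real (card (shifted_points P rp rm s t k)) / real k ^ card P) \<longlonglongrightarrow>
    (\<Sum>(P1, P2) \<in> ordered_bipartitions P.
      num_lin_ext P1 (Restr rp P1) / fact (card P1) * (num_lin_ext P2 (Restr rm P2) / fact (card P2)))"
proof -
  have lim: "(\<lambda>k. real (card (chain_bounded_maps Q (Restr r Q) u k)) / real k ^ card Q) \<longlonglongrightarrow>
      num_lin_ext Q (Restr r Q) / fact (card Q)"
    if "partial_order_on P r" "Q \<subseteq> P" "u \<in> {0, 1}" for Q r u
  proof -
    have Q: "finite Q" "partial_order_on Q (Restr r Q)"
      using that fin by (auto intro: finite_subset partial_order_on_Restr)
    from that(3) consider "u = 0" | "u = 1" by blast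
    then show ?thesis
    proof cases
      case 1
      then show ?thesis
        using order_poly_Suc_tendsto[OF Q] by (simp add: card_chain_bounded_maps_0[OF Q])
    next
      case 2
      then show ?thesis
        using strict_order_poly_tendsto[OF Q] card_chain_bounded_maps_1[OF Q] by simp
    qed
  qed
  let ?c = "\<lambda>Q r u k. real (card (chain_bounded_maps Q (Restr r Q) u k))"
  have eq: "real (card (shifted_points P rp rm s t k)) / real k ^ card P =
      (\<Sum>(P1, P2) \<in> ordered_bipartitions P.
        ?c P1 rp s k / real k ^ card P1 * (?c P2 rm t k / real k ^ card P2))" for k
    unfolding card_shifted_points[OF fin rp rm] of_nat_sum sum_divide_distrib
    by (rule sum.cong) (auto simp: ordered_bipartitionsD(5)[OF _ fin] power_add)
  show ?thesis
    unfolding eq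
  proof (rule tendsto_sum, clarsimp simp only: split_paired_all prod.case)
    fix P1 P2 assume "(P1, P2) \<in> ordered_bipartitions P"
    then show "(\<lambda>k. ?c P1 rp s k / real k ^ card P1 * (?c P2 rm t k / real k ^ card P2)) \<longlonglongrightarrow>
      num_lin_ext P1 (Restr rp P1) / fact (card P1) * (num_lin_ext P2 (Restr rm P2) / fact (card P2))"
      using ordered_bipartitionsD(1,2)[OF _ fin] st by (intro tendsto_mult lim rp rm) auto
  qed
qed

text \<open>The volume, as a constant sequence, is squeezed between the normalised inner and outer
  counts. The factorial of \<open>card P\<close> over those of the two blocks is the
  binomial.\<close>

lemma measure_signed_region:
  assumes fin: "finite P" and rp: "partial_order_on P rp" and rm: "partial_order_on P rm"
  shows "fact (card P) * measure (Pi\<^sub>M P (\<lambda>_. lborel)) (signed_region P rp rm 1 \<inter> extensional P)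
    = real (\<Sum>(P1, P2) \<in> ordered_bipartitions P.
        (card P choose card P1) * num_lin_ext P1 (Restr rp P1) * num_lin_ext P2 (Restr rm P2))"
proof -
  define V where "V = measure (Pi\<^sub>M P (\<lambda>_. lborel)) (signed_region P rp rm 1 \<inter> extensional P)"
  let ?L = "\<Sum>(P1, P2) \<in> ordered_bipartitions P.
      real (num_lin_ext P1 (Restr rp P1)) / fact (card P1) * (real (num_lin_ext P2 (Restr rm P2)) / fact (card P2))"
  have "(\<lambda>k::nat. V) \<longlonglongrightarrow> ?L"
  proof (rule tendsto_sandwich[OF _ _ card_shifted_points_tendsto[OF fin rp rm, of 1 1]
        card_shifted_points_tendsto[OF fin rp rm, of 0 0]])
    show "\<forall>\<^sub>F k in sequentially. real (card (shifted_points P rp rm 1 1 k)) / real k ^ card P \<le> V"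
      unfolding V_def by (rule eventually_sequentiallyI[of 1]) (rule measure_signed_region_bounds[OF fin rp rm])
    show "\<forall>\<^sub>F k in sequentially. V \<le> real (card (shifted_points P rp rm 0 0 k)) / real k ^ card P"
      unfolding V_def by (rule eventually_sequentiallyI[of 1]) (rule measure_signed_region_bounds[OF fin rp rm])
  qed simp_all
  then have "V = ?L" by (simp add: LIMSEQ_const_iff)
  then have "fact (card P) * V = (\<Sum>(P1, P2) \<in> ordered_bipartitions P.
      fact (card P) * (real (num_lin_ext P1 (Restr rp P1)) / fact (card P1) * (real (num_lin_ext P2 (Restr rm P2)) / fact (card P2))))"
    by (simp add: sum_distrib_left case_prod_unfold)
  also have "\<dots> = (\<Sum>(P1, P2) \<in> ordered_bipartitions P.
      real ((card P choose card P1) * num_lin_ext P1 (Restr rp P1) * num_lin_ext P2 (Restr rm P2)))"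
  proof (rule sum.cong[OF refl], clarsimp simp only: split_paired_all prod.case)
    fix P1 P2 assume "(P1, P2) \<in> ordered_bipartitions P"
    then have "card P = card P1 + card P2" using ordered_bipartitionsD(5)[OF _ fin] by blast
    then have "real (card P choose card P1) = fact (card P) / (fact (card P1) * fact (card P2))"
      by (simp add: binomial_fact)
    then show "fact (card P) * (real (num_lin_ext P1 (Restr rp P1)) / fact (card P1) *
          (real (num_lin_ext P2 (Restr rm P2)) / fact (card P2))) =
        real ((card P choose card P1) * num_lin_ext P1 (Restr rp P1) * num_lin_ext P2 (Restr rm P2))"
      by simp
  qed
  finally show ?thesis unfolding V_def by (simp add: case_prod_unfold)
qed

text \<open>Membership depends only on the coordinates in \<open>P\<close>, so exchanging the
  default 0 outside \<open>P\<close> for \<open>undefined\<close> is harmless. This links the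
  polytope to the product measure space.\<close>

lemma restrict_signed_region:
  "(\<lambda>x. restrict x P) ` {x \<in> signed_region P rp rm m. \<forall>a. a \<notin> P \<longrightarrow> x a = 0} =
    signed_region P rp rm m \<inter> extensional P"
proof -
  have cong: "x \<in> signed_region P rp rm m \<longleftrightarrow> y \<in> signed_region P rp rm m" if "\<And>a. a \<in> P \<Longrightarrow> x a = y a" for x y
  proof -
    have "sum (\<lambda>a. f (x a)) C = sum (\<lambda>a. f (y a)) C" if "C \<subseteq> P" for C and f :: "real \<Rightarrow> real"
      using \<open>\<And>a. a \<in> P \<Longrightarrow> x a = y a\<close> that by (auto intro!: sum.cong)
    from this[of _ "\<lambda>u. max 0 u"] this[of _ "\<lambda>u. max 0 (- u)"] show ?thesis
      by (simp add: signed_region_def chain_bounded_def)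
  qed
  show ?thesis
  proof (intro set_eqI iffI)
    fix y assume "y \<in> (\<lambda>x. restrict x P) ` {x \<in> signed_region P rp rm m. \<forall>a. a \<notin> P \<longrightarrow> x a = 0}"
    then obtain x where x: "x \<in> signed_region P rp rm m" and y: "y = restrict x P" by blast
    then have "y \<in> signed_region P rp rm m" using cong[of y x] by simp
    then show "y \<in> signed_region P rp rm m \<inter> extensional P" by (simp add: y)
  next
    fix y assume y: "y \<in> signed_region P rp rm m \<inter> extensional P"
    define x where "x a = (if a \<in> P then y a else 0)" for a
    have "x \<in> signed_region P rp rm m" using y cong[of x y] by (simp add: x_def)
    moreover have "y = restrict x P" using y by (auto simp: x_def extensional_def fun_eq_iff)
    ultimately show "y \<in> (\<lambda>x. restrict x P) ` {x \<in> signed_region P rp rm m. \<forall>a. a \<notin> P \<longrightarrow> x a = 0}"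
      by (auto simp: x_def)
  qed
qed

theorem theorem4p7:
  fixes P :: "'a set" and rp rm :: "'a rel"
  assumes "double_poset P rp rm"
  defines "D \<equiv> minkowski_diff (chain_polytope P rp) (chain_polytope P rm)"
  shows "lattice_polytope P D
    \<and> (\<forall>n::nat. n \<ge> 1 \<longrightarrow>
         card ((\<lambda>x. real (n - 1) *\<^sub>R x) ` D \<inter> int_lattice P)
         = (\<Sum>(P1, P2) \<in> ordered_bipartitions P.
              strict_order_poly P1 (Restr rp P1) (n - 1) * order_poly P2 (Restr rm P2) n))
    \<and> nvol P D
         = real (\<Sum>(P1, P2) \<in> ordered_bipartitions P.
              (card P choose card P1) * num_lin_ext P1 (Restr rp P1) * num_lin_ext P2 (Restr rm P2))"
proof (intro conjI allI impI)
  have fin: "finite P" and rp: "partial_order_on P rp" and rm: "partial_order_on P rm"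
    using assms(1) by (auto simp: double_poset_def)
  note scaled = scaled_minkowski_diff_chain_polytopes[OF rp rm]
  show "lattice_polytope P D"
    unfolding D_def
    by (intro lattice_polytope_minkowski_diff lattice_polytope_chain_polytope fin rp rm)
  show "card ((\<lambda>x. real (n - 1) *\<^sub>R x) ` D \<inter> int_lattice P)
      = (\<Sum>(P1, P2) \<in> ordered_bipartitions P.
           strict_order_poly P1 (Restr rp P1) (n - 1) * order_poly P2 (Restr rm P2) n)"
    if "n \<ge> 1" for n
  proof -
    have "card ((\<lambda>x. real (n - 1) *\<^sub>R x) ` D \<inter> int_lattice P) = card (shifted_points P rp rm 1 0 (n - 1))"
      unfolding D_def scaled[OF of_nat_0_le_iff] by (rule card_lattice_points[OF fin])
    also have "\<dots> = (\<Sum>(P1, P2) \<in> ordered_bipartitions P.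
        card (chain_bounded_maps P1 (Restr rp P1) 1 (n - 1)) * card (chain_bounded_maps P2 (Restr rm P2) 0 (n - 1)))"
      by (rule card_shifted_points[OF fin rp rm])
    also have "\<dots> = (\<Sum>(P1, P2) \<in> ordered_bipartitions P.
        strict_order_poly P1 (Restr rp P1) (n - 1) * order_poly P2 (Restr rm P2) n)"
    proof (rule sum.cong[OF refl], clarsimp simp only: split_paired_all prod.case)
      fix P1 P2 assume "(P1, P2) \<in> ordered_bipartitions P"
      note part = ordered_bipartitionsD[OF this fin]
      show "card (chain_bounded_maps P1 (Restr rp P1) 1 (n - 1)) * card (chain_bounded_maps P2 (Restr rm P2) 0 (n - 1)) =
          strict_order_poly P1 (Restr rp P1) (n - 1) * order_poly P2 (Restr rm P2) n"
        unfolding card_chain_bounded_maps_1[OF part(3) partial_order_on_Restr[OF rp part(1)]]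
          card_chain_bounded_maps_0[OF part(4) partial_order_on_Restr[OF rm part(2)]]
        \<comment> \<open>The assumption \<open>n \<ge> 1\<close> turns \<open>Suc (n - 1)\<close>,
          the argument of the weak count, into \<open>n\<close>.\<close>
        using that by simp
    qed
    finally show ?thesis .
  qed
  have "D = {x \<in> signed_region P rp rm 1. \<forall>a. a \<notin> P \<longrightarrow> x a = 0}"
    using scaled[of 1] by (simp add: D_def)
  then show "nvol P D = real (\<Sum>(P1, P2) \<in> ordered_bipartitions P.
      (card P choose card P1) * num_lin_ext P1 (Restr rp P1) * num_lin_ext P2 (Restr rm P2))"
    unfolding nvol_def using measure_signed_region[OF fin rp rm] by (simp only: restrict_signed_region)
qed

end
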